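(* Let $\Gamma=(S,R)$ be a finite simple connected graph which is nondegenerate but is not the line graph of any simple graph. Then $\Gamma$ is $2$-lit. Moreover, the following are equivalent: (i) $\Gamma$ is $1$-lit; (ii) the restriction of $Q$ to the set $\{\alpha_s^\vee\mid s\in S\}$ is surjective onto $\mathbb{F}_2$.
   Context: Let $V$ be the $\mathbb{F}_2$-vector space with basis $\{\alpha_s\mid s\in S\}$, and let $V^\ast$ be its dual space with dual basis $\{f_s\mid s\in S\}$, so $f_s(\alpha_t)=\delta_{st}$. Let $B$ be the bilinear form on $V$ with $B(\alpha_s,\alpha_t)=1$ if $st\in R$ and $0$ otherwise. $\Gamma$ is nondegenerate if $B$ is nondegenerate, equivalently if the adjacency matrix of $\Gamma$ over $\mathbb{F}_2$ is invertible. When $B$ is nondegenerate, $\{\alpha_s^\vee\mid s\in S\}$ denotes the basis of $V$ dual to $\{\alpha_s\}$ with respect to $B$, i.e. $B(\alpha_s^\vee,\alpha_t)=\delta_{st}$ for all $s,t\in S$. Let $Q:V\to\mathbb{F}_2$ be the unique quadratic form with $Q(\alpha+\beta)=Q(\alpha)+Q(\beta)+B(\alpha,\beta)$ for all $\alpha,\beta$ and $Q(\alpha_s)=1$ for all $s\in S$. Lit-only $\sigma$-game: a configuration is an element $f\in V^\ast$, where vertex $t$ is "on" iff $f(\alpha_t)=1$. For $s\in S$, the move $\kappa_s:V^\ast\to V^\ast$ is $\kappa_s f=f+f(\alpha_s)\sum_{st\in R}f_t$; that is, if $s$ is on, the states of all neighbors of $s$ are toggled. Given an integer $k$, $\Gamma$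 is $k$-lit if for every configuration the number of on vertices can be reduced to at most $k$ by a finite sequence of moves. The line graph of a graph $G$ has the edges of $G$ as vertices, adjacent iff they share an endpoint. *)

theory Defs
  imports "HOL-Analysis.Cartesian_Space" "HOL-Library.Z2"
begin

subsection \<open>Graphs\<close>

definition simple_graph :: "'a set \<Rightarrow> 'a set set \<Rightarrow> bool" where
  "simple_graph S R \<longleftrightarrow> (\<forall>e\<in>R. e \<subseteq> S \<and> card e = 2)"

definition connected_graph :: "'a set \<Rightarrow> 'a set set \<Rightarrow> bool" where
  "connected_graph S R \<longleftrightarrow> (\<forall>s\<in>S. \<forall>t\<in>S. (s, t) \<in> {(x, y). {x, y} \<in> R}\<^sup>*)"

definition graph_isomorphic :: "'a set \<Rightarrow> 'a set set \<Rightarrow> 'b set \<Rightarrow> 'b set set \<Rightarrow> bool" where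
  "graph_isomorphic S R S' R' \<longleftrightarrow>
     (\<exists>\<phi>. bij_betw \<phi> S S' \<and> (\<forall>s\<in>S. \<forall>t\<in>S. {s, t} \<in> R \<longleftrightarrow> {\<phi> s, \<phi> t} \<in> R'))"

text \<open>The line graph of \<open>(W, E)\<close> has vertex set \<open>E\<close> and the following edges.\<close>

definition line_graph_edges :: "'a set set \<Rightarrow> 'a set set set" where
  "line_graph_edges E = {{e, e'} | e e'. e \<in> E \<and> e' \<in> E \<and> e \<noteq> e' \<and> e \<inter> e' \<noteq> {}}"

text \<open>Taking the vertices of the root graph in \<^typ>\<open>nat\<close> is no restriction for a graph
  with finitely many vertices: see \<open>is_line_graphI\<close> below.\<close>

definition is_line_graph :: "'a set \<Rightarrow> 'a set set \<Rightarrow> bool" where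
  "is_line_graph S R \<longleftrightarrow>
     (\<exists>(W :: nat set) E. simple_graph W E \<and> graph_isomorphic S R E (line_graph_edges E))"

lemma doubleton_in_line_graph_edges:
  assumes "e \<in> E" "e' \<in> E"
  shows "{e, e'} \<in> line_graph_edges E \<longleftrightarrow> e \<noteq> e' \<and> e \<inter> e' \<noteq> {}"
  using assms unfolding line_graph_edges_def mem_Collect_eq doubleton_eq_iff by blast

lemma is_line_graphI:
  fixes W :: "'b set"
  assumes fin: "finite S" and W: "simple_graph W E"
    and iso: "graph_isomorphic S R E (line_graph_edges E)"
  shows "is_line_graph S R"
proof -
  obtain \<phi> where \<phi>: "bij_betw \<phi> S E"
    "\<And>s t. s \<in> S \<Longrightarrow> t \<in> S \<Longrightarrow> {s, t} \<in> R \<longleftrightarrow> {\<phi> s, \<phi> t} \<in> line_graph_edges E"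
    using iso unfolding graph_isomorphic_def by blast
  have finE: "finite E" using \<phi>(1) fin bij_betw_finite by blast
  have card2: "\<And>e. e \<in> E \<Longrightarrow> card e = 2" using W by (auto simp: simple_graph_def)
  have "\<And>e. e \<in> E \<Longrightarrow> finite e" using card2 by (metis card.infinite zero_neq_numeral)
  with finE have finU: "finite (\<Union>E)" by blast
  obtain h :: "'b \<Rightarrow> nat" where h: "inj_on h (\<Union>E)"
    using finite_imp_inj_to_nat_seg[OF finU] by auto
  have sub: "\<And>e. e \<in> E \<Longrightarrow> e \<subseteq> \<Union>E" by blast
  have img_eq: "h ` e = h ` e' \<longleftrightarrow> e = e'" if "e \<in> E" "e' \<in> E" for e e'
    using inj_on_image_eq_iff[OF h] that by blast
  have img_int: "h ` e \<inter> h ` e' = {} \<longleftrightarrow> e \<inter> e' = {}" if "e \<in> E" "e' \<in> E" for e e'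
    using inj_on_image_Int[OF h sub[OF that(1)] sub[OF that(2)]] by (metis image_is_empty)
  let ?E = "(`) h ` E"
  have inj: "inj_on ((`) h) E" using img_eq by (auto simp: inj_on_def)
  have "simple_graph UNIV ?E"
    unfolding simple_graph_def
  proof (intro ballI conjI)
    fix e' assume "e' \<in> ?E"
    then obtain e where e: "e \<in> E" "e' = h ` e" by blast
    show "card e' = 2"
      unfolding e(2) using card_image[OF inj_on_subset[OF h sub[OF e(1)]]] card2[OF e(1)] by simp
  qed simp
  moreover have adj: "{e, e'} \<in> line_graph_edges E \<longleftrightarrow> {h ` e, h ` e'} \<in> line_graph_edges ?E"
    if e: "e \<in> E" "e' \<in> E" for e e'
  proof -
    have 1: "{e, e'} \<in> line_graph_edges E \<longleftrightarrow> e \<noteq> e' \<and> e \<inter> e' \<noteq> {}"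
      by (rule doubleton_in_line_graph_edges[OF e])
    have 2: "{h ` e, h ` e'} \<in> line_graph_edges ?E \<longleftrightarrow> h ` e \<noteq> h ` e' \<and> h ` e \<inter> h ` e' \<noteq> {}"
      by (rule doubleton_in_line_graph_edges[OF imageI[OF e(1)] imageI[OF e(2)]])
    show ?thesis unfolding 1 2 img_eq[OF e] img_int[OF e] ..
  qed
  have "bij_betw ((`) h \<circ> \<phi>) S ?E"
    using \<phi>(1) inj by (intro bij_betw_trans) (auto simp: bij_betw_def)
  moreover have "\<forall>s\<in>S. \<forall>t\<in>S. {s, t} \<in> R \<longleftrightarrow> {((`) h \<circ> \<phi>) s, ((`) h \<circ> \<phi>) t} \<in> line_graph_edges ?E"
    using \<phi> adj by (auto simp: bij_betw_apply)
  ultimately show ?thesis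
    unfolding is_line_graph_def graph_isomorphic_def by blast
qed

subsection \<open>The forms on \<open>V\<close>\<close>

text \<open>The vertex set \<open>S\<close> of \<open>\<Gamma>\<close> is a finite type \<open>'s\<close>, the space \<open>V\<close> is \<open>bit ^ 's\<close>.\<close>

definition alpha :: "'s \<Rightarrow> bit ^ 's::finite" where
  "alpha s = axis s 1"

definition B_form :: "'s set set \<Rightarrow> bit ^ 's \<Rightarrow> bit ^ 's::finite \<Rightarrow> bit" where
  "B_form R x y = (\<Sum>s\<in>UNIV. \<Sum>t\<in>UNIV. x $ s * y $ t * (if {s, t} \<in> R then 1 else 0))"

definition nondegenerate :: "'s::finite set set \<Rightarrow> bool" where
  "nondegenerate R \<longleftrightarrow> (\<forall>x. (\<forall>y. B_form R x y = 0) \<longrightarrow> x = 0)"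

definition is_Q_form :: "'s set set \<Rightarrow> (bit ^ 's::finite \<Rightarrow> bit) \<Rightarrow> bool" where
  "is_Q_form R q \<longleftrightarrow>
     (\<forall>c x. q (c *s x) = c\<^sup>2 * q x) \<and>
     (\<forall>x y. q (x + y) = q x + q y + B_form R x y) \<and>
     (\<forall>s. q (alpha s) = 1)"

definition Q_form :: "'s set set \<Rightarrow> bit ^ 's::finite \<Rightarrow> bit" where
  "Q_form R = (THE q. is_Q_form R q)"

definition alpha_dual :: "'s set set \<Rightarrow> 's \<Rightarrow> bit ^ 's::finite" where
  "alpha_dual R s = (THE v. \<forall>t. B_form R v (alpha t) = (if s = t then 1 else 0))"

lemma B_form_alpha: "B_form R (alpha s) (alpha t) = (if {s, t} \<in> R then 1 else 0)"
proof -
  have "B_form R (alpha s) (alpha t) =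
      (\<Sum>s'\<in>UNIV. \<Sum>t'\<in>UNIV. if s' = s then (if t' = t then (if {s', t'} \<in> R then 1 else 0) else 0) else 0)"
    unfolding B_form_def alpha_def axis_def by (intro sum.cong refl) auto
  also have "\<dots> = (\<Sum>s'\<in>UNIV. if s' = s then (\<Sum>t'\<in>UNIV. if t' = t then (if {s', t'} \<in> R then 1 else 0) else 0) else 0)"
    by (intro sum.cong refl) auto
  finally show ?thesis by (simp add: sum.delta)
qed

lemma B_form_add_left: "B_form R (x + y) z = B_form R x z + B_form R y z"
  unfolding B_form_def vector_add_component distrib_left distrib_right sum.distrib ..

lemma B_form_add_right: "B_form R x (y + z) = B_form R x y + B_form R x z"
  unfolding B_form_def vector_add_component distrib_left distrib_right sum.distrib ..

lemma B_form_scale_left: "B_form R (c *s x) y = c * B_form R x y"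
  unfolding B_form_def vector_smult_component sum_distrib_left mult.assoc ..

lemma B_form_scale_right: "B_form R x (c *s y) = c * B_form R x y"
  unfolding B_form_def vector_smult_component sum_distrib_left
  by (intro sum.cong refl) (simp only: mult_ac)

lemma is_Q_form_exists:
  assumes "simple_graph UNIV R"
  shows "is_Q_form R (\<lambda>x. (\<Sum>s\<in>UNIV. (x $ s)\<^sup>2) + (\<Sum>e\<in>R. \<Prod>s\<in>e. x $ s))"
proof -
  have double: "a + a = 0" for a :: bit by (cases a) simp_all
  have sq: "a\<^sup>2 = a" for a :: bit by (cases a) simp_all
  have card2: "card e = 2" if "e \<in> R" for e using assms that by (auto simp: simple_graph_def)
  have cross: "(\<Prod>s\<in>e. (x + y) $ s) =
      (\<Prod>s\<in>e. x $ s) + (\<Prod>s\<in>e. y $ s) + (\<Sum>(s, t)\<in>{(s, t). {s, t} = e}. x $ s * y $ t)"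
    if eR: "e \<in> R" for e and x y :: "bit ^ 'a"
  proof -
    obtain a b where e: "e = {a, b}" "a \<noteq> b" using card2[OF eR] by (auto simp: card_2_iff)
    have "{(s, t). {s, t} = e} = {(a, b), (b, a)}" using e by (auto simp: doubleton_eq_iff)
    then have "(\<Sum>(s, t)\<in>{(s, t). {s, t} = e}. x $ s * y $ t) = x $ a * y $ b + x $ b * y $ a"
      using e by simp
    moreover have "(\<Prod>s\<in>e. z s) = z a * z b" for z :: "'a \<Rightarrow> bit" using e by simp
    ultimately show ?thesis
      by (simp only: vector_add_component distrib_left distrib_right add_ac mult_ac)
  qed
  have "B_form R x y = (\<Sum>(s, t)\<in>UNIV. x $ s * y $ t * (if {s, t} \<in> R then 1 else 0))"
    for x y :: "bit ^ 'a"
    unfolding B_form_def by (simp only: sum.cartesian_product UNIV_Times_UNIV)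
  also have "(\<Sum>(s, t)\<in>UNIV. x $ s * y $ t * (if {s, t} \<in> R then 1 else 0))
      = (\<Sum>(s, t)\<in>{(s, t). {s, t} \<in> R}. x $ s * y $ t)" for x y :: "bit ^ 'a"
    by (intro sum.mono_neutral_cong_right) (auto split: if_splits)
  also have "(\<Sum>(s, t)\<in>{(s, t). {s, t} \<in> R}. x $ s * y $ t)
      = (\<Sum>e\<in>R. \<Sum>(s, t)\<in>{(s, t). {s, t} = e}. x $ s * y $ t)" for x y :: "bit ^ 'a"
  proof -
    have "(\<Sum>e\<in>R. \<Sum>p\<in>{p \<in> {(s, t). {s, t} \<in> R}. (\<lambda>(s, t). {s, t}) p = e}. (\<lambda>(s, t). x $ s * y $ t) p)
        = (\<Sum>p\<in>{(s, t). {s, t} \<in> R}. (\<lambda>(s, t). x $ s * y $ t) p)"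
      by (rule sum.group) auto
    moreover have "{p \<in> {(s, t). {s, t} \<in> R}. (\<lambda>(s, t). {s, t}) p = e} = {(s, t). {s, t} = e}"
      if "e \<in> R" for e using that by auto
    ultimately show ?thesis by (metis (no_types, lifting) sum.cong)
  qed
  finally have B: "B_form R x y = (\<Sum>e\<in>R. \<Sum>(s, t)\<in>{(s, t). {s, t} = e}. x $ s * y $ t)"
    for x y :: "bit ^ 'a" .
  show ?thesis unfolding is_Q_form_def
  proof (intro conjI allI)
    fix c and x :: "bit ^ 'a"
    have "(\<Sum>e\<in>R. \<Prod>s\<in>e. (0::bit ^ 'a) $ s) = 0"
      using card2 by (intro sum.neutral ballI) (force simp: card_2_iff)
    then show "(\<Sum>s\<in>UNIV. ((c *s x) $ s)\<^sup>2) + (\<Sum>e\<in>R. \<Prod>s\<in>e. (c *s x) $ s) =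
        c\<^sup>2 * ((\<Sum>s\<in>UNIV. (x $ s)\<^sup>2) + (\<Sum>e\<in>R. \<Prod>s\<in>e. x $ s))"
      by (cases c) (simp_all only: sq, simp_all)
  next
    fix x y :: "bit ^ 'a"
    have "(\<Sum>e\<in>R. \<Prod>s\<in>e. (x + y) $ s) =
        (\<Sum>e\<in>R. \<Prod>s\<in>e. x $ s) + (\<Sum>e\<in>R. \<Prod>s\<in>e. y $ s) + B_form R x y"
      unfolding B sum.distrib[symmetric] using cross by (intro sum.cong refl)
    then show "(\<Sum>s\<in>UNIV. ((x + y) $ s)\<^sup>2) + (\<Sum>e\<in>R. \<Prod>s\<in>e. (x + y) $ s) =
        (\<Sum>s\<in>UNIV. (x $ s)\<^sup>2) + (\<Sum>e\<in>R. \<Prod>s\<in>e. x $ s) +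
        ((\<Sum>s\<in>UNIV. (y $ s)\<^sup>2) + (\<Sum>e\<in>R. \<Prod>s\<in>e. y $ s)) + B_form R x y"
      by (simp only: sq vector_add_component sum.distrib add_ac)
  next
    fix a :: 'a
    have "\<forall>e\<in>R. (\<Prod>s\<in>e. alpha a $ s) = 0"
    proof
      fix e assume eR: "e \<in> R"
      obtain b c where "e = {b, c}" "b \<noteq> c" using card2[OF eR] by (auto simp: card_2_iff)
      then show "(\<Prod>s\<in>e. alpha a $ s) = 0" by (auto simp: alpha_def axis_def)
    qed
    then have "(\<Sum>e\<in>R. \<Prod>s\<in>e. alpha a $ s) = 0" by (rule sum.neutral)
    moreover have "(\<Sum>s\<in>UNIV. (alpha a $ s)\<^sup>2) = 1"
      unfolding sq by (simp add: alpha_def axis_def sum.delta)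
    ultimately show "(\<Sum>s\<in>UNIV. (alpha a $ s)\<^sup>2) + (\<Sum>e\<in>R. \<Prod>s\<in>e. alpha a $ s) = 1"
      by (simp only: add_0_right)
  qed
qed

lemma is_Q_form_unique:
  assumes p: "is_Q_form R p" and q: "is_Q_form R q"
  shows "p = q"
proof
  fix x :: "bit ^ 'a"
  have zero: "p 0 = 0" "q 0 = 0"
    using p q unfolding is_Q_form_def by (metis mult_zero_left power_zero_numeral vec.scale_zero_left)+
  have "p (\<Sum>s\<in>A. x $ s *s alpha s) = q (\<Sum>s\<in>A. x $ s *s alpha s)" if "finite A" for A
    using that
  proof (induction A)
    case empty
    show ?case using zero by (simp only: sum.empty)
  next
    case (insert a A)
    have "r (\<Sum>s\<in>insert a A. x $ s *s alpha s) = (x $ a)\<^sup>2 + r (\<Sum>s\<in>A. x $ s *s alpha s)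
        + B_form R (x $ a *s alpha a) (\<Sum>s\<in>A. x $ s *s alpha s)" if "is_Q_form R r" for r
    proof -
      have r: "r (c *s y) = c\<^sup>2 * r y" "r (y + z) = r y + r z + B_form R y z" "r (alpha s) = 1" for c y z s
        using that unfolding is_Q_form_def by blast+
      show ?thesis unfolding sum.insert[OF insert.hyps] r mult_1_right ..
    qed
    from this[OF p] this[OF q] show ?case by (simp only: insert.IH)
  qed
  from this[of UNIV] show "p x = q x"
    unfolding alpha_def by (simp only: basis_expansion finite)
qed

lemma is_Q_form_Q_form:
  assumes "simple_graph UNIV R"
  shows "is_Q_form R (Q_form R)"
  unfolding Q_form_def
  by (rule theI[of "is_Q_form R", OF is_Q_form_exists[OF assms]])
    (rule is_Q_form_unique[OF _ is_Q_form_exists[OF assms]])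

lemma alpha_dual_ex1:
  assumes "nondegenerate R"
  shows "\<exists>!v. \<forall>t. B_form R v (alpha t) = (if s = t then 1 else 0)"
proof -
  define F where "F v = (\<chi> t. B_form R v (alpha t))" for v
  have lin: "Vector_Spaces.linear (*s) (*s) F"
    by unfold_locales (simp_all only: F_def vec_eq_iff vec_lambda_beta vector_add_component
        vector_smult_component B_form_add_left B_form_scale_left simp_thms)
  have expand: "B_form R v y = (\<Sum>t\<in>UNIV. y $ t * B_form R v (alpha t))" for v y
  proof -
    have "B_form R v (\<Sum>t\<in>A. y $ t *s alpha t) = (\<Sum>t\<in>A. y $ t * B_form R v (alpha t))"
      if "finite A" for A
      using that
    proof (induction A)
      case empty
      have "B_form R v (0 *s 0) = 0 * B_form R v 0" by (rule B_form_scale_right)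
      then show ?case by (simp only: sum.empty vec.scale_zero_left mult_zero_left)
    next
      case (insert a A)
      then show ?case by (simp only: sum.insert B_form_add_right B_form_scale_right simp_thms)
    qed
    from this[of UNIV] show ?thesis unfolding alpha_def by (simp only: basis_expansion finite)
  qed
  have "v = 0" if "F v = 0" for v
  proof -
    have "B_form R v (alpha t) = 0" for t
      using arg_cong[OF that, of "\<lambda>w. w $ t"] by (simp only: F_def vec_lambda_beta zero_index)
    then have "B_form R v y = 0" for y
      by (subst expand) (simp only: mult_zero_right sum.neutral_const)
    then show ?thesis using assms unfolding nondegenerate_def by blast
  qed
  then have inj: "inj F" using vec.linear_inj_iff_eq_0[OF lin] by blast
  have "surj F" by (rule vec.linear_injective_imp_surjective[OF lin inj refl])
  with inj have "\<exists>!v. F v = axis s 1" by (metis injD surjD)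
  moreover have "F v = axis s 1 \<longleftrightarrow> (\<forall>t. B_form R v (alpha t) = (if s = t then 1 else 0))" for v
    unfolding F_def vec_eq_iff axis_def vec_lambda_beta by (simp only: eq_commute)
  ultimately show ?thesis by simp
qed

lemma B_form_alpha_dual:
  assumes "nondegenerate R"
  shows "B_form R (alpha_dual R s) (alpha t) = (if s = t then 1 else 0)"
  using theI'[OF alpha_dual_ex1[OF assms, of s]] unfolding alpha_dual_def by blast

subsection \<open>The lit-only \<open>\<sigma>\<close>-game\<close>

definition dual_space :: "(bit ^ 's::finite \<Rightarrow> bit) set" where
  "dual_space = {f. Vector_Spaces.linear (*s) (*) f}"

definition dual_basis :: "'s \<Rightarrow> bit ^ 's::finite \<Rightarrow> bit" where
  "dual_basis s = (\<lambda>v. v $ s)"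

definition kappa :: "'s set set \<Rightarrow> 's \<Rightarrow> (bit ^ 's::finite \<Rightarrow> bit) \<Rightarrow> (bit ^ 's \<Rightarrow> bit)" where
  "kappa R s f = (\<lambda>v. f v + f (alpha s) * (\<Sum>t | {s, t} \<in> R. dual_basis t v))"

definition on_vertices :: "(bit ^ 's::finite \<Rightarrow> bit) \<Rightarrow> 's set" where
  "on_vertices f = {t. f (alpha t) = 1}"

definition k_lit :: "'s::finite set set \<Rightarrow> int \<Rightarrow> bool" where
  "k_lit R k \<longleftrightarrow>
     (\<forall>f\<in>dual_space. \<exists>moves. int (card (on_vertices (fold (kappa R) moves f))) \<le> k)"

lemma dual_basis_in_dual_space: "dual_basis s \<in> dual_space"
  unfolding dual_space_def dual_basis_def mem_Collect_eq
  by unfold_locales (simp_all only: vector_add_component vector_smult_component)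

lemma dual_basis_alpha: "dual_basis s (alpha t) = (if s = t then 1 else 0)"
  by (simp add: dual_basis_def alpha_def axis_def)

end

theory Submission
  imports Defs
begin

text \<open>
  Identify a configuration \<open>f\<close> with the vector \<open>v\<close> such that \<open>f = B(v, \<cdot>)\<close>; the moves become the
  transvections \<open>v \<mapsto> v + B(v, \<alpha>\<^sub>s)\<alpha>\<^sub>s\<close>, which preserve \<open>Q\<close>, and the number of on vertices is the number
  of dual basis vectors in \<open>v\<close>. Let the roots be the closure of the \<open>\<alpha>\<^sub>s\<close> under sums of
  nonorthogonal pairs. Take a largest set \<open>C\<close> of pairwise nonorthogonal roots. If every root meets
  \<open>C\<close> as in type \<open>A\<close>, then maximality forces each \<open>\<alpha>\<^sub>s\<close> to be a sum of two elements of \<open>C \<union> {0}\<close>,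
  and the graph is the line graph on these pairs. Otherwise the roots contain an \<open>E\<^sub>6\<close> system
  modulo 2, whose span \<open>U\<close> is nondegenerate; spreading along \<open>U \<oplus> U\<^sup>\<bottom>\<close> shows that all vectors with
  \<open>Q = 1\<close> are roots. Then the nonzero vectors with a given value of \<open>Q\<close> form one orbit, so only the
  values of \<open>Q\<close> on the sums of one or two dual basis vectors matter.
\<close>

section \<open>Roots of binary quadratic spaces\<close>

text \<open>Scalars of F_2 are encoded as \<open>bool\<close>, so that their sum is exclusive or and
  identities between forms become propositional. \<open>span_A\<close> expresses spanning as an
  induction rule.\<close>

locale binary_quadratic_space =
  fixes b :: "'v::{ab_group_add,finite} \<Rightarrow> 'v \<Rightarrow> bool" and q :: "'v \<Rightarrow> bool" and A :: "'v set"
  assumes dbl: "(x::'v) + x = 0"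
    and b_add_left: "b (x + y) z \<longleftrightarrow> b x z \<noteq> b y z"
    and b_sym: "b x y \<longleftrightarrow> b y x"
    and q_add: "q (x + y) \<longleftrightarrow> (q x \<noteq> (q y \<noteq> b x y))"
    and q_A: "a \<in> A \<Longrightarrow> q a"
    and connected_A: "a \<in> A \<Longrightarrow> a' \<in> A \<Longrightarrow> (a, a') \<in> {(x, y). x \<in> A \<and> y \<in> A \<and> b x y}\<^sup>*"
    and nondegenerate_A: "(\<And>a. a \<in> A \<Longrightarrow> \<not> b v a) \<Longrightarrow> v = 0"
    and span_A [case_names zero add]: "P 0 \<Longrightarrow> (\<And>a v. a \<in> A \<Longrightarrow> P v \<Longrightarrow> P (a + v)) \<Longrightarrow> P v"
begin

lemma b_add_right: "b z (x + y) \<longleftrightarrow> b z x \<noteq> b z y"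
  using b_add_left b_sym by blast

lemma b_zero [simp]: "\<not> b 0 x" "\<not> b x 0"
  using b_add_left[of 0 0 x] b_add_right[of x 0 0] by auto

lemma q_zero [simp]: "\<not> q 0"
  using q_add[of 0 0] by simp

lemma b_self [simp]: "\<not> b x x"
  using q_add[of x x] dbl[of x] by auto

lemma add_cancel2 [simp]: "x + (x + y) = (y::'v)"
  using dbl[of x] by (simp add: add.assoc[symmetric])

lemmas b_add = b_add_left b_add_right
lemmas ac = add_ac dbl add_cancel2

lemma add_eq_0: "x + y = (0::'v) \<longleftrightarrow> x = y"
  by (metis add_cancel2 dbl add.right_neutral)

section \<open>Roots and the orbits of the transvections\<close>

inductive_set roots :: "'v set" where
  simple: "a \<in> A \<Longrightarrow> a \<in> roots"
| add: "x \<in> roots \<Longrightarrow> y \<in> roots \<Longrightarrow> b x y \<Longrightarrow> x + y \<in> roots"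

lemma q_roots: "x \<in> roots \<Longrightarrow> q x"
  by (induction rule: roots.induct) (auto simp: q_A q_add)

definition moves :: "('v \<times> 'v) set" where
  "moves = {(v, v + a) | v a. a \<in> A \<and> b v a}"

lemma moves_sym: "sym (moves\<^sup>*)"
proof (rule sym_rtrancl, rule symI)
  fix v w assume "(v, w) \<in> moves"
  then obtain a where "a \<in> A" "b v a" "w = v + a" by (auto simp: moves_def)
  then have "a \<in> A" "b w a" "v = w + a" by (auto simp: b_add ac)
  then show "(w, v) \<in> moves" by (auto simp: moves_def)
qed

text \<open>If \<open>b v (x + y)\<close>, exactly one of \<open>b v x\<close> and
  \<open>b v y\<close> holds. After adding that vector the other one becomes nonorthogonal, since
  \<open>b x y\<close>, so two shorter walks compose.\<close>

lemma moves_root: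
  assumes "a \<in> roots" "b v a"
  shows "(v, v + a) \<in> moves\<^sup>*"
  using assms
proof (induction arbitrary: v rule: roots.induct)
  case (simple a)
  then show ?case by (auto simp: moves_def)
next
  case (add x y)
  show ?case
  proof (cases "b v x")
    case True
    then have "b (v + x) y" using add.prems add.hyps by (auto simp: b_add)
    then show ?thesis using add.IH(1)[OF True] add.IH(2)[of "v + x"] by (simp add: add_ac)
  next
    case False
    then have "b v y" "b (v + y) x" using add.prems add.hyps by (auto simp: b_add b_sym)
    then show ?thesis using add.IH(2)[of v] add.IH(1)[of "v + y"] by (simp add: add_ac)
  qed
qed

lemma moves_from_simple:
  assumes "x \<in> roots" shows "\<exists>a\<in>A. (a, x) \<in> moves\<^sup>*"
  using assms
proof (induction rule: roots.induct)
  case (add x y)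
  then show ?case using moves_root[of y x] by (meson rtrancl_trans)
qed auto

text \<open>Neighbours \<open>y\<close> and \<open>z\<close> are joined by the walk
  \<open>y\<close>, \<open>y + z\<close>, \<open>z\<close>.\<close>

lemma moves_simple:
  assumes "a \<in> A" "a' \<in> A" shows "(a, a') \<in> moves\<^sup>*"
  using connected_A[OF assms]
proof (induction rule: rtrancl_induct)
  case (step y z)
  then have yz: "b y z" "y \<in> roots" "z \<in> roots" by (auto intro: roots.simple)
  then have "(y, y + z) \<in> moves\<^sup>*" "(y + z, y + z + y) \<in> moves\<^sup>*"
    using moves_root[of z y] moves_root[of y "y + z"] by (auto simp: b_add b_sym)
  then show ?case using step.IH by (auto simp: ac)
qed simp

lemma moves_roots:
  assumes "x \<in> roots" "y \<in> roots" shows "(x, y) \<in> moves\<^sup>*"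
  using moves_from_simple[OF assms(1)] moves_from_simple[OF assms(2)] moves_simple
  by (meson moves_sym rtrancl_trans symD)

lemma common_nonorthogonal:
  assumes "v \<noteq> 0" "w \<noteq> 0" obtains x where "b v x" "b w x"
proof -
  obtain x y where "b v x" "b w y" using assms nondegenerate_A by metis
  then show ?thesis using that[of x] that[of y] that[of "x + y"] by (auto simp: b_add)
qed

text \<open>Nonorthogonal singular \<open>x\<close>, \<open>y\<close> satisfy
  \<open>q (x + y)\<close>, so the transvection at the root \<open>x + y\<close> takes one to the
  other. Orthogonal ones are joined through a third singular vector.\<close>

lemma moves_singular:
  assumes all: "\<And>x. q x \<Longrightarrow> x \<in> roots"
    and v: "v \<noteq> 0" "\<not> q v" and w: "w \<noteq> 0" "\<not> q w"
  shows "(v, w) \<in> moves\<^sup>*"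
proof -
  have one: "(x, y) \<in> moves\<^sup>*" if "\<not> q x" "\<not> q y" "b x y" for x y
    using moves_root[of "x + y" x] that all[of "x + y"] by (auto simp: b_add q_add ac)
  show ?thesis
  proof (cases "b v w")
    case True
    then show ?thesis using one v w by blast
  next
    case False
    obtain x where x: "b v x" "b w x" using common_nonorthogonal v w by metis
    \<comment> \<open>If \<open>q x\<close>, passing to \<open>x + v\<close> makes \<open>q\<close>
      vanish, as \<open>q x\<close> and \<open>b x v\<close> cancel; the pairings with
      \<open>v\<close> and \<open>w\<close> do not change.\<close>
    obtain y where y: "b v y" "b w y" "\<not> q y"
    proof (cases "q x")
      case True
      then show ?thesis using that[of "x + v"] x v False by (auto simp: b_add q_add b_sym)
    qed (use that x in blast)
    show ?thesis using one[of v y] one[of y w] y v w by (meson b_sym rtrancl_trans)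
  qed
qed

section \<open>Cliques of roots and type A\<close>

definition clique :: "'v set \<Rightarrow> bool" where
  "clique C \<longleftrightarrow> 0 \<notin> C \<and> (\<forall>x\<in>C. \<forall>y\<in>C. b x y \<longleftrightarrow> x \<noteq> y)"

lemma clique_insert:
  assumes "clique C" "\<And>y. y \<in> C \<Longrightarrow> b x y" "x \<noteq> 0"
  shows "clique (insert x C)"
  using assms unfolding clique_def by (metis b_self b_sym insert_iff)

text \<open>The sums of pairs of \<open>insert 0 C\<close> form a root system of type \<open>A\<close> modulo 2.\<close>

lemma b_clique_pairs:
  assumes "clique C" "i \<in> insert 0 C" "j \<in> insert 0 C" "k \<in> insert 0 C" "l \<in> insert 0 C"
    and "i \<noteq> j" "k \<noteq> l" "{i, j} \<noteq> {k, l}"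
  shows "b (i + j) (k + l) \<longleftrightarrow> {i, j} \<inter> {k, l} \<noteq> {}"
proof -
  have "b x y \<longleftrightarrow> x \<noteq> y \<and> x \<noteq> 0 \<and> y \<noteq> 0" if "x \<in> insert 0 C" "y \<in> insert 0 C" for x y
    using that assms(1) by (auto simp: clique_def)
  then show ?thesis using assms(2-) by (auto simp: b_add)
qed

text \<open>The first five roots give type A_5 on the six points 0, \<open>x\<close>,
  \<open>y\<close>, \<open>z\<close>, \<open>t\<close>, \<open>u\<close>. Pairing with
  \<open>g\<close> splits these points into the triples \<open>x\<close>, \<open>y\<close>,
  \<open>z\<close> and 0, \<open>t\<close>, \<open>u\<close>, as does the node of E_6 attached to
  the middle of A_5.\<close>

definition e6_diagram :: "'v \<Rightarrow> 'v \<Rightarrow> 'v \<Rightarrow> 'v \<Rightarrow> 'v \<Rightarrow> 'v \<Rightarrow> bool" where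
  "e6_diagram x y z t u g \<longleftrightarrow> {x, y, z, t, u, g} \<subseteq> roots \<and>
     b x y \<and> b x z \<and> b x t \<and> b x u \<and> b y z \<and> b y t \<and> b y u \<and> b z t \<and> b z u \<and> b t u \<and>
     b g x \<and> b g y \<and> b g z \<and> \<not> b g t \<and> \<not> b g u"

text \<open>On a largest clique \<open>C\<close> every root pairs like 0 or like a sum of two
  points, up to an error orthogonal to \<open>C\<close>. Maximality makes the error vanish for roots
  that meet \<open>C\<close>, and connectedness shows that all simple roots do.\<close>

lemma simple_roots_pairs:
  assumes "A \<noteq> {}" and no_e6: "\<nexists>x y z t u g. e6_diagram x y z t u g"
  obtains C where "clique C"
    "\<And>a. a \<in> A \<Longrightarrow> \<exists>i\<in>insert 0 C. \<exists>j\<in>insert 0 C. i \<noteq> j \<and> a = i + j"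
proof -
  define F where "F = {C. clique C \<and> C \<subseteq> roots}"
  have "{} \<in> F" by (auto simp: F_def clique_def)
  then have "Max (card ` F) \<in> card ` F" by (intro Max_in) auto
  then obtain C where CF: "C \<in> F" and "card C = Max (card ` F)" by auto
  then have max: "card D \<le> card C" if "D \<in> F" for D using that by simp
  have C: "clique C" "C \<subseteq> roots" using CF by (auto simp: F_def)
  have bC: "b x y" if "x \<in> C" "y \<in> C" "x \<noteq> y" for x y using C that by (auto simp: clique_def)
  have roots0: "0 \<notin> roots" using q_roots q_zero by blast
  have ext: False if x: "x \<in> roots" "\<And>y. y \<in> C \<Longrightarrow> b x y" for x
  proof -
    have "insert x C \<in> F" using clique_insert[OF C(1)] x roots0 C(2) by (auto simp: F_def)
    moreover have "x \<notin> C" using x(2) b_self by blast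
    ultimately show False using max[of "insert x C"] by simp
  qed
  have "C \<noteq> {}" using ext assms(1) roots.simple by blast
  \<comment> \<open>Pairing with \<open>g\<close> splits \<open>insert 0 C\<close> into two classes.
    A class of size 1 contradicts maximality, a class of size 2 is matched by the sum of its
    elements, and two classes of size at least 3 contain an E_6 diagram.\<close>
  have cases_root: "(\<forall>x\<in>C. \<not> b g x) \<or>
      (\<exists>i\<in>insert 0 C. \<exists>j\<in>insert 0 C. i \<noteq> j \<and> (\<forall>x\<in>C. \<not> b (i + j + g) x))"
    if g: "g \<in> roots" for g
  proof (rule ccontr)
    assume n: "\<not> ?thesis"
    then obtain x where x: "x \<in> C" "b g x" by blast
    have pair: "\<exists>x\<in>C. b (i + j + g) x" if "i \<in> insert 0 C" "j \<in> insert 0 C" "i \<noteq> j" for i j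
      using n that by metis
    have "\<exists>y\<in>C. y \<noteq> x \<and> b g y"
    proof (rule ccontr)
      assume "\<not> ?thesis"
      then have "b (g + x) w" if "w \<in> C" for w
        using x that bC[OF x(1) that] by (cases "w = x") (auto simp: b_add)
      moreover have "g + x \<in> roots" using g x C roots.add by blast
      ultimately show False using ext by blast
    qed
    then obtain y where y: "y \<in> C" "y \<noteq> x" "b g y" by blast
    have "\<exists>z\<in>C. z \<noteq> x \<and> z \<noteq> y \<and> b g z"
    proof (rule ccontr)
      assume no: "\<not> ?thesis"
      have "\<not> b (x + y + g) w" if "w \<in> C" for w
        using x y no that bC[OF x(1) that] bC[OF y(1) that] by (cases "w = x"; cases "w = y") (auto simp: b_add)
      then show False using pair[of x y] x y by blast
    qed
    then obtain z where z: "z \<in> C" "z \<noteq> x" "z \<noteq> y" "b g z" by blast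
    obtain t where t: "t \<in> C" "\<not> b g t" using ext g by blast
    have "\<exists>u\<in>C. u \<noteq> t \<and> \<not> b g u"
    proof (rule ccontr)
      assume no: "\<not> ?thesis"
      have "\<not> b (0 + t + g) w" if "w \<in> C" for w
        using t no that bC[OF t(1) that] by (cases "w = t") (auto simp: b_add)
      moreover have "t \<noteq> 0" using t(1) C(1) by (auto simp: clique_def)
      ultimately show False using pair[of 0 t] t by blast
    qed
    then obtain u where u: "u \<in> C" "u \<noteq> t" "\<not> b g u" by blast
    have "e6_diagram x y z t u g" unfolding e6_diagram_def
      using x y z t u g C(2) bC by (smt (verit) insert_subset subset_iff empty_subsetI)
    with no_e6 show False by blast
  qed
  \<comment> \<open>Transvections at \<open>k\<close> and then at \<open>x\<close> carry
    \<open>x + z\<close> to \<open>k + z\<close>.\<close>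
  have shift: "k + z \<in> roots" if z: "\<forall>x\<in>C. \<not> b z x" and x: "x \<in> C" "x + z \<in> roots" and k: "k \<in> C" for x z k
  proof (cases "k = x")
    case False
    then have bk: "b x k" using bC x k by blast
    then have "x + z + k \<in> roots" using x k z C(2) by (intro roots.add[of "x + z"]) (auto simp: b_add)
    moreover have "b (x + z + k) x" using bk z x k by (auto simp: b_add b_sym)
    ultimately have "x + z + k + x \<in> roots" using x C(2) roots.add by blast
    then show ?thesis by (simp add: ac)
  qed (use x in simp)
  have shift_pair: "k + z \<in> roots"
    if ij: "i \<in> insert 0 C" "j \<in> insert 0 C" "i \<noteq> j" and z: "\<forall>x\<in>C. \<not> b z x" and r: "i + j + z \<in> roots" and k: "k \<in> C"
    for i j z k
  proof (cases "i = 0 \<or> j = 0")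
    case True
    then show ?thesis using ij r shift[OF z _ _ k] by auto
  next
    case False
    then have iC: "i \<in> C" "j \<in> C" using ij by auto
    then have "b (i + j + z) i" using z bC[of j i] ij by (auto simp: b_add)
    then have "i + j + z + i \<in> roots" using r iC C(2) roots.add by blast
    then have "j + z \<in> roots" by (simp add: ac)
    then show ?thesis using shift[OF z iC(2) _ k] by blast
  qed
  \<comment> \<open>Otherwise replacing \<open>x\<close> in \<open>C\<close> by the two roots
    \<open>x + z\<close> and \<open>x + z'\<close>, nonorthogonal because of \<open>b z z'\<close>,
    would enlarge the clique.\<close>
  have no_pair: False
    if z: "\<forall>x\<in>C. \<not> b z x" "\<forall>x\<in>C. \<not> b z' x" "b z z'" and x: "x \<in> C" "x + z \<in> roots" "x + z' \<in> roots" for x z z'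
  proof -
    let ?D = "C - {x}"
    have D: "clique ?D" using C(1) by (auto simp: clique_def)
    have 1: "b (x + z) y" "b (x + z') y" if "y \<in> ?D" for y
      using that z x bC[of x y] by (auto simp: b_add)
    have bb: "b (x + z) (x + z')" using z x(1) by (auto simp: b_add b_sym)
    have nz: "x + z \<noteq> 0" "x + z' \<noteq> 0" using roots0 x by auto
    have c1: "clique (insert (x + z') ?D)" by (rule clique_insert[OF D 1(2) nz(2)])
    have "clique (insert (x + z) (insert (x + z') ?D))"
      by (rule clique_insert[OF c1 _ nz(1)]) (use 1(1) bb in blast)
    then have "insert (x + z) (insert (x + z') ?D) \<in> F" using x C(2) by (auto simp: F_def)
    moreover have "card (insert (x + z) (insert (x + z') ?D)) = Suc (Suc (card ?D))"
    proof -
      have "x + z' \<notin> ?D" "x + z \<notin> insert (x + z') ?D" using 1 bb by (metis b_self, metis b_self insertE)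
      then show ?thesis by simp
    qed
    moreover have "card C = Suc (card ?D)" by (metis card_Suc_Diff1 finite x(1))
    ultimately show False using max by (metis Suc_n_not_le_n)
  qed
  \<comment> \<open>A simple root \<open>y\<close> with \<open>b z y\<close> would yield a second
    vector orthogonal to \<open>C\<close>, either \<open>z + y\<close> or \<open>i + j + y\<close>,
    which together with \<open>z\<close> contradicts \<open>no_pair\<close>.\<close>
  have zero: "z = 0" if z: "\<forall>x\<in>C. \<not> b z x" "\<forall>k\<in>C. k + z \<in> roots" for z
  proof (rule nondegenerate_A, rule notI)
    fix y assume y: "y \<in> A" "b z y"
    have yr: "y \<in> roots" using y roots.simple by blast
    obtain x where x: "x \<in> C" using \<open>C \<noteq> {}\<close> by blast
    from cases_root[OF yr] show False
    proof (elim disjE bexE conjE)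
      assume yC: "\<forall>x\<in>C. \<not> b y x"
      have "x + z + y \<in> roots" using z x y yC by (intro roots.add[of "x + z"] yr) (auto simp: b_add b_sym)
      then show False using no_pair[of z "z + y" x] z x y yC by (auto simp: b_add add.assoc)
    next
      fix i j assume ij: "i \<in> insert 0 C" "j \<in> insert 0 C" "i \<noteq> j" and w: "\<forall>x\<in>C. \<not> b (i + j + y) x"
      have "i + j + (i + j + y) = y" by (simp add: ac)
      then have "x + (i + j + y) \<in> roots" using shift_pair[OF ij w _ x] yr by simp
      moreover have "b z (i + j + y)" using z y ij by (auto simp: b_add)
      ultimately show False using no_pair[of z "i + j + y" x] z w x by blast
    qed
  qed
  have pair: "\<exists>i\<in>insert 0 C. \<exists>j\<in>insert 0 C. i \<noteq> j \<and> g = i + j" if g: "g \<in> roots" "\<exists>x\<in>C. b g x" for g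
  proof -
    obtain i j where ij: "i \<in> insert 0 C" "j \<in> insert 0 C" "i \<noteq> j" and w: "\<forall>x\<in>C. \<not> b (i + j + g) x"
      using cases_root[OF g(1)] g(2) by blast
    have "i + j + (i + j + g) = g" by (simp add: ac)
    then have "\<forall>k\<in>C. k + (i + j + g) \<in> roots" using shift_pair[OF ij w] g by simp
    then have "i + j + g = 0" using zero w by blast
    then have "g = i + j" using add_eq_0[of "i + j" g] by simp
    then show ?thesis using ij by blast
  qed
  obtain x where x: "x \<in> C" using \<open>C \<noteq> {}\<close> by blast
  then have "x \<noteq> 0" using C(1) by (auto simp: clique_def)
  then obtain a0 where a0: "a0 \<in> A" "b x a0" using nondegenerate_A by blast
  \<comment> \<open>A neighbour of \<open>i + j\<close> is nonorthogonal to \<open>i\<close> or to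
    \<open>j\<close>, so meeting \<open>C\<close> propagates along edges.\<close>
  have nonorth: "\<exists>x\<in>C. b a x" if a: "a \<in> A" for a
    using connected_A[OF a0(1) a]
  proof (induction rule: rtrancl_induct)
    case base
    then show ?case using x a0 b_sym by blast
  next
    case (step y z)
    then obtain i j where "i \<in> insert 0 C" "j \<in> insert 0 C" "y = i + j" "b y z"
      using pair roots.simple by blast
    then show ?case by (auto simp: b_add b_sym)
  qed
  show thesis
    using that[OF C(1)] pair nonorth roots.simple by blast
qed

end

section \<open>Spaces containing the roots of \<open>E\<^sub>6\<close>\<close>

text \<open>
  The roots of \<open>E\<^sub>6\<close> modulo 2 in the coordinates of three orthogonal anisotropic planes, that is, of
  the subsystem \<open>3A\<^sub>2\<close>: the nonzero vectors of the planes and the sums of three of them, one from each plane.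
\<close>

locale e6_frame = binary_quadratic_space +
  fixes p p' r r' s s' :: 'a
  assumes frame_roots: "p \<in> roots" "p' \<in> roots" "r \<in> roots" "r' \<in> roots" "s \<in> roots" "s' \<in> roots"
      "p + r + s \<in> roots"
    and frame_pairs: "b p p'" "b r r'" "b s s'"
    and frame_orth: "\<not> b p r" "\<not> b p r'" "\<not> b p' r" "\<not> b p' r'"
      "\<not> b p s" "\<not> b p s'" "\<not> b p' s" "\<not> b p' s'"
      "\<not> b r s" "\<not> b r s'" "\<not> b r' s" "\<not> b r' s'"
begin

lemma frame_sym: "b p' p" "b r' r" "b s' s"
  "\<not> b r p" "\<not> b r' p" "\<not> b r p'" "\<not> b r' p'" "\<not> b s p" "\<not> b s' p" "\<not> b s p'" "\<not> b s' p'"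
  "\<not> b s r" "\<not> b s' r" "\<not> b s r'" "\<not> b s' r'"
  using frame_pairs frame_orth b_sym by blast+

lemmas frame_b = frame_pairs frame_orth frame_sym

lemma frame_q: "q p" "q p'" "q r" "q r'" "q s" "q s'"
  using frame_roots q_roots by blast+

section \<open>The orthogonal splitting along the frame\<close>

definition Uperp :: "'a set" where
  "Uperp = {w. \<not> b w p \<and> \<not> b w p' \<and> \<not> b w r \<and> \<not> b w r' \<and> \<not> b w s \<and> \<not> b w s'}"

text \<open>This is the span of the frame, written as a double orthogonal complement so that closure
  under addition is immediate.\<close>

definition U :: "'a set" where
  "U = {u. \<forall>w\<in>Uperp. \<not> b u w}"

lemma U_perp: "u \<in> U \<Longrightarrow> w \<in> Uperp \<Longrightarrow> \<not> b u w" "u \<in> U \<Longrightarrow> w \<in> Uperp \<Longrightarrow> \<not> b w u"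
  using b_sym by (auto simp: U_def)

lemma U_add: "u \<in> U \<Longrightarrow> v \<in> U \<Longrightarrow> u + v \<in> U"
  by (auto simp: U_def b_add)

lemma Uperp_add: "u \<in> Uperp \<Longrightarrow> v \<in> Uperp \<Longrightarrow> u + v \<in> Uperp"
  by (auto simp: Uperp_def b_add)

lemma zero_U: "0 \<in> U" "0 \<in> Uperp"
  by (auto simp: U_def Uperp_def)

lemma frame_U: "p \<in> U" "p' \<in> U" "r \<in> U" "r' \<in> U" "s \<in> U" "s' \<in> U"
  using b_sym by (auto simp: U_def Uperp_def)

definition plane :: "'a \<Rightarrow> 'a \<Rightarrow> 'a set" where
  "plane x y = {0, x, y, x + y}"

lemma decompose_planes:
  obtains x y z w where "v = x + y + z + w" "x \<in> plane p p'" "y \<in> plane r r'" "z \<in> plane s s'"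
    "x + y + z \<in> U" "w \<in> Uperp"
proof -
  \<comment> \<open>When \<open>b x y\<close>, the basis of the plane dual to \<open>x\<close>,
    \<open>y\<close> is \<open>y\<close>, \<open>x\<close>; hence \<open>pr x y\<close> is the
    orthogonal projection of \<open>v\<close>.\<close>
  define pr where "pr x y = (if b v y then x else 0) + (if b v x then y else 0)" for x y
  have pl: "pr x y \<in> plane x y" for x y by (auto simp: pr_def plane_def)
  let ?u = "pr p p' + pr r r' + pr s s'"
  have U: "?u \<in> U" using frame_U zero_U by (intro U_add) (auto simp: pr_def intro!: U_add)
  have "?u + v \<in> Uperp" by (auto simp: Uperp_def pr_def b_add frame_b)
  moreover have "v = ?u + (?u + v)" by simp
  ultimately show ?thesis using that[of "pr p p'" "pr r r'" "pr s s'" "?u + v"] pl U by blast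
qed

lemma decompose: obtains u w where "v = u + w" "u \<in> U" "w \<in> Uperp"
  by (rule decompose_planes[of v]) (use that in blast)

lemma U_Uperp_0:
  assumes "u \<in> U" "u \<in> Uperp" shows "u = 0"
proof (rule nondegenerate_A)
  fix a
  obtain x w where "a = x + w" "x \<in> U" "w \<in> Uperp" by (rule decompose)
  then show "\<not> b u a" using assms U_perp by (auto simp: b_add)
qed

lemma U_nondegenerate:
  assumes "u \<in> U" "u \<noteq> 0" obtains x where "x \<in> U" "b u x"
proof -
  have "u \<notin> Uperp" using U_Uperp_0 assms by blast
  then show ?thesis using that frame_U unfolding Uperp_def by blast
qed

lemma U_common_nonorthogonal:
  assumes "v \<in> U" "v \<noteq> 0" "w \<in> U" "w \<noteq> 0" obtains x where "x \<in> U" "b v x" "b w x"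
proof -
  obtain x where x: "x \<in> U" "b v x" using U_nondegenerate assms by blast
  obtain y where y: "y \<in> U" "b w y" using U_nondegenerate assms by blast
  show ?thesis using x y that[of x] that[of y] that[of "x + y"] U_add by (auto simp: b_add)
qed

section \<open>Roots with a fixed component in \<open>Uperp\<close>\<close>

definition linked :: "'a \<Rightarrow> bool" where
  "linked u \<longleftrightarrow> u \<in> U \<and> u \<in> roots \<and> (\<forall>w\<in>Uperp. u + w \<in> roots \<longleftrightarrow> p + w \<in> roots)"

text \<open>The transvection at the root \<open>u + x\<close> exchanges \<open>u + w\<close> and
  \<open>x + w\<close> for all \<open>w\<close> in \<open>Uperp\<close>.\<close>

lemma linked_step:
  assumes u: "linked u" and x: "x \<in> roots" "x \<in> U" "b u x"
  shows "linked x"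
proof -
  have ux: "u \<in> U" "u \<in> roots" "u + x \<in> roots" using u x roots.add by (auto simp: linked_def)
  have "u + w \<in> roots \<longleftrightarrow> x + w \<in> roots" if w: "w \<in> Uperp" for w
  proof -
    have "b (u + w) (u + x)" "b (x + w) (u + x)"
      using U_perp[OF _ w] ux x b_sym[of x u] by (auto simp: b_add)
    then have "u + w \<in> roots \<Longrightarrow> u + w + (u + x) \<in> roots" "x + w \<in> roots \<Longrightarrow> x + w + (u + x) \<in> roots"
      using ux(3) roots.add by blast+
    then show ?thesis by (auto simp: ac)
  qed
  then show ?thesis using u x by (auto simp: linked_def)
qed

lemma linked_add:
  assumes u: "linked u" and x: "x \<in> roots" "x \<in> U" "b u x"
  shows "linked (u + x)"
  using assms by (intro linked_step[OF u] U_add roots.add) (auto simp: linked_def b_add)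

lemma plane_add_root:
  assumes "x \<in> roots" "y \<in> roots" "b x y" "v \<in> plane x y" "v \<noteq> 0"
  shows "v \<in> roots"
  using assms roots.add by (auto simp: plane_def)

lemma planes_in_U: "plane p p' \<subseteq> U" "plane r r' \<subseteq> U" "plane s s' \<subseteq> U"
  using frame_U zero_U U_add by (auto simp: plane_def)

lemma planes_roots:
  assumes "x \<noteq> 0" "x \<in> plane p p' \<or> x \<in> plane r r' \<or> x \<in> plane s s'"
  shows "x \<in> roots" "x \<in> U"
  using assms plane_add_root[of _ _ x] frame_roots frame_pairs planes_in_U by blast+

text \<open>The chain \<open>p\<close>, \<open>p'\<close>, \<open>p + r + s\<close> of successively
  nonorthogonal roots links one transversal sum; its three components are then changed one at a
  time.\<close>

lemma linked_transversal:
  assumes "x \<in> plane p p'" "x \<noteq> 0" "y \<in> plane r r'" "y \<noteq> 0" "z \<in> plane s s'" "z \<noteq> 0"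
  shows "linked (x + y + z)"
proof -
  have "linked p" using frame_U frame_roots by (auto simp: linked_def)
  then have "linked p'" using linked_step frame_roots frame_U frame_pairs by blast
  then have 0: "linked (p + r + s)"
    by (rule linked_step) (use frame_roots frame_U U_add in \<open>auto simp: b_add frame_b\<close>)
  \<comment> \<open>As \<open>v\<close> is orthogonal to the plane, adding \<open>e + e'\<close> or
    \<open>e'\<close> replaces the component \<open>e\<close> by \<open>e'\<close> or
    \<open>e + e'\<close>.\<close>
  have swap: "linked (v + k)" if "linked (v + e)" "k \<in> plane e e'" "k \<noteq> 0" "e \<in> roots" "e \<in> U" "e' \<in> roots" "e' \<in> U"
      "b e e'" "\<not> b v e" "\<not> b v e'" for v k e e'
  proof -
    have "e + e' \<in> roots" using that roots.add by blast
    then have "linked (v + e + (e + e'))" "linked (v + e + e')"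
      using that U_add by (auto intro!: linked_add simp: b_add)
    then show ?thesis using that by (auto simp: plane_def ac)
  qed
  have "linked (r + s + p)" using 0 by (simp add: add_ac)
  then have "linked (r + s + x)"
    by (rule swap[where e' = p']) (use assms frame_roots frame_U in \<open>auto simp: b_add frame_b\<close>)
  then have "linked (s + x + r)" by (simp add: add_ac)
  then have "linked (s + x + y)"
    by (rule swap[where e' = r']) (use assms frame_roots frame_U in \<open>auto simp: b_add frame_b plane_def\<close>)
  then have "linked (x + y + s)" by (simp add: add_ac)
  then show ?thesis
    by (rule swap[where e' = s']) (use assms frame_roots frame_U in \<open>auto simp: b_add frame_b plane_def\<close>)
qed

lemma plane_other:
  assumes "x \<in> plane e e'" "x \<noteq> 0" "b e e'" obtains y where "y \<in> plane e e'" "y \<noteq> 0" "b y x"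
proof -
  have "e \<noteq> 0" "e' \<noteq> 0" "b e' e" using assms(3) b_sym by auto
  then show ?thesis using assms that[of e] that[of e'] by (auto simp: plane_def b_add)
qed

text \<open>A nonzero plane vector is nonorthogonal to any transversal sum whose component in that
  plane is another nonzero vector.\<close>

lemma linked_plane:
  assumes x: "x \<noteq> 0" "x \<in> plane p p' \<or> x \<in> plane r r' \<or> x \<in> plane s s'"
  shows "linked x"
proof -
  have nz: "p \<noteq> 0" "r \<noteq> 0" "s \<noteq> 0" using frame_pairs by auto
  have in_pl: "p \<in> plane p p'" "r \<in> plane r r'" "s \<in> plane s s'" by (auto simp: plane_def)
  from x(2) have "\<exists>v. linked v \<and> b v x"
  proof (elim disjE)
    assume xp: "x \<in> plane p p'"
    then obtain y where y: "y \<in> plane p p'" "y \<noteq> 0" "b y x" using plane_other x(1) frame_pairs by metis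
    moreover have "b (y + r + s) x" using y xp by (auto simp: b_add frame_b plane_def)
    ultimately show ?thesis using linked_transversal in_pl nz by blast
  next
    assume xp: "x \<in> plane r r'"
    then obtain y where y: "y \<in> plane r r'" "y \<noteq> 0" "b y x" using plane_other x(1) frame_pairs by metis
    moreover have "b (p + y + s) x" using y xp by (auto simp: b_add frame_b plane_def)
    ultimately show ?thesis using linked_transversal in_pl nz by blast
  next
    assume xp: "x \<in> plane s s'"
    then obtain y where y: "y \<in> plane s s'" "y \<noteq> 0" "b y x" using plane_other x(1) frame_pairs by metis
    moreover have "b (p + r + y) x" using y xp by (auto simp: b_add frame_b plane_def)
    ultimately show ?thesis using linked_transversal in_pl nz by blast
  qed
  then show ?thesis using linked_step planes_roots[OF x] by blast
qed

text \<open>The planes are anisotropic and mutually orthogonal, so \<open>q u\<close> says that the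
  number of nonzero components is odd. This gives 9 + 27 = 36 vectors, the positive roots of
  E_6.\<close>

lemma linked_U:
  assumes u: "u \<in> U" "q u" shows "linked u"
proof -
  obtain x y z w where v: "u = x + y + z + w" and pl: "x \<in> plane p p'" "y \<in> plane r r'" "z \<in> plane s s'"
    and w: "x + y + z \<in> U" "w \<in> Uperp" by (rule decompose_planes)
  have "w = x + y + z + u" by (simp add: v ac)
  then have "w = 0" using U_Uperp_0 U_add u w by metis
  then have v: "u = x + y + z" using v by simp
  have "q x \<longleftrightarrow> x \<noteq> 0" "q y \<longleftrightarrow> y \<noteq> 0" "q z \<longleftrightarrow> z \<noteq> 0"
    using planes_roots q_roots q_zero pl by metis+
  moreover have "\<not> b x y" "\<not> b x z" "\<not> b y z" using pl by (auto simp: plane_def b_add frame_b)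
  ultimately have "(x \<noteq> 0) \<noteq> ((y \<noteq> 0) \<noteq> (z \<noteq> 0))" using u(2) by (auto simp: v q_add b_add)
  then show ?thesis unfolding v using linked_transversal linked_plane pl by (cases "x = 0"; cases "y = 0"; cases "z = 0") auto
qed

text \<open>If \<open>q u\<close>, both vectors are linked. Otherwise the argument of
  \<open>moves_singular\<close> is repeated inside \<open>U\<close>, where sums of nonorthogonal
  singular vectors are roots by \<open>linked_U\<close>.\<close>

lemma roots_coset:
  assumes u: "u \<in> U" "u \<noteq> 0" and v: "v \<in> U" "v \<noteq> 0" and w: "w \<in> Uperp"
    and "q u \<longleftrightarrow> q v" and r: "u + w \<in> roots"
  shows "v + w \<in> roots"
proof (cases "q u")
  case True
  then show ?thesis using linked_U assms by (auto simp: linked_def)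
next
  case False
  have one: "y + w \<in> roots" if "x + w \<in> roots" "x \<in> U" "y \<in> U" "\<not> q x" "\<not> q y" "b x y" for x y
  proof -
    have "x + y \<in> roots" using linked_U[of "x + y"] that U_add by (auto simp: linked_def q_add)
    moreover have "b (x + w) (x + y)" using that U_perp w by (auto simp: b_add)
    ultimately have "x + w + (x + y) \<in> roots" using that roots.add by blast
    then show ?thesis by (simp add: ac)
  qed
  have qv: "\<not> q v" using False assms by simp
  show ?thesis
  proof (cases "b u v")
    case True
    then show ?thesis using one False qv r u v by blast
  next
    case F: False
    obtain x where x: "x \<in> U" "b u x" "b v x" using U_common_nonorthogonal u v by metis
    obtain y where y: "y \<in> U" "b u y" "b v y" "\<not> q y"
    proof (cases "q x")
      case True
      have "b v (x + u)" "b u (x + u)" "\<not> q (x + u)"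
        using True x False F b_sym[of u v] b_sym[of u x] by (auto simp: b_add q_add)
      then show ?thesis using that[of "x + u"] U_add x u by blast
    qed (use that x in blast)
    then show ?thesis using one[of u y] one[of y v] r u v False qv b_sym[of y v] by blast
  qed
qed

section \<open>Spreading from \<open>U\<close> to its complement\<close>

definition T :: "'a set" where
  "T = {w \<in> Uperp. \<exists>u\<in>U. u \<noteq> 0 \<and> u + w \<in> roots}"

lemma T_root:
  assumes "w \<in> T" "u \<in> U" "u \<noteq> 0" "q u \<noteq> q w"
  shows "u + w \<in> roots"
proof -
  obtain v where v: "v \<in> U" "v \<noteq> 0" "v + w \<in> roots" and w: "w \<in> Uperp" using assms by (auto simp: T_def)
  have "q v \<noteq> q w" using q_roots[OF v(3)] U_perp v w by (auto simp: q_add)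
  then show ?thesis using roots_coset[OF v(1,2) assms(2,3) w _ v(3)] assms by blast
qed

lemma U_pair:
  obtains u v where "u \<in> U" "v \<in> U" "u \<noteq> 0" "v \<noteq> 0" "u + v \<noteq> 0"
    "q u \<longleftrightarrow> c" "q v \<longleftrightarrow> d" "b u v \<longleftrightarrow> e"
proof -
  have nz: "x \<noteq> 0" if "b x y" for x y using that by auto
  note mk = that
  \<comment> \<open>The vectors \<open>x\<close>, \<open>y\<close>, \<open>z\<close> certify that
    \<open>u\<close>, \<open>v\<close> and \<open>u + v\<close> are nonzero.\<close>
  have that': thesis if "u \<in> U" "v \<in> U" "b u x" "b v y" "b (u + v) z"
      "q u \<longleftrightarrow> c" "q v \<longleftrightarrow> d" "b u v \<longleftrightarrow> e" for u v x y z
    using mk[of u v] nz that by blast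
  note f = frame_U frame_b frame_q U_add b_add q_add
  show thesis
  proof (cases c; cases d; cases e)
    assume "c" "d" "e" then show thesis by (intro that'[of p p' p' p p]) (simp_all add: f)
  next
    assume "c" "d" "\<not> e" then show thesis by (intro that'[of p r p' r' p']) (simp_all add: f)
  next
    assume "c" "\<not> d" "e" then show thesis by (intro that'[of p "p' + r" p' p p]) (simp_all add: f)
  next
    assume "c" "\<not> d" "\<not> e" then show thesis by (intro that'[of p "r + s" p' r' p']) (simp_all add: f)
  next
    assume "\<not> c" "d" "e" then show thesis by (intro that'[of "p' + r" p p p' p]) (simp_all add: f)
  next
    assume "\<not> c" "d" "\<not> e" then show thesis by (intro that'[of "r + s" p r' p' p']) (simp_all add: f)
  next
    assume "\<not> c" "\<not> d" "e" then show thesis by (intro that'[of "p + r" "p' + r" p' p p]) (simp_all add: f)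
  next
    assume "\<not> c" "\<not> d" "\<not> e" then show thesis by (intro that'[of "p + r" "p + s" p' p' r']) (simp_all add: f)
  qed
qed

text \<open>\<open>U_pair\<close> supplies components \<open>u\<close>, \<open>v\<close> for which
  \<open>u + w\<close> and \<open>v + w'\<close> are nonorthogonal roots and \<open>u + v\<close> is
  nonzero.\<close>

lemma T_add:
  assumes "w \<in> T" "w' \<in> T" shows "w + w' \<in> T"
proof -
  have w: "w \<in> Uperp" "w' \<in> Uperp" using assms by (auto simp: T_def)
  obtain u v where uv: "u \<in> U" "v \<in> U" "u \<noteq> 0" "v \<noteq> 0" "u + v \<noteq> 0"
    "q u \<longleftrightarrow> \<not> q w" "q v \<longleftrightarrow> \<not> q w'" "b u v \<longleftrightarrow> \<not> b w w'" by (rule U_pair)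
  have "u + w \<in> roots" "v + w' \<in> roots" using T_root assms uv by auto
  moreover have "b (u + w) (v + w')" using U_perp w uv by (auto simp: b_add)
  ultimately have "u + w + (v + w') \<in> roots" using roots.add by blast
  then have "u + v + (w + w') \<in> roots" by (simp add: add_ac)
  then show ?thesis using uv U_add Uperp_add w by (auto simp: T_def)
qed

text \<open>The set \<open>U + T\<close> is closed under addition. Connectedness brings all simple
  roots into it, starting from one nonorthogonal to \<open>p\<close>; since they span,
  \<open>U + T\<close> is the whole space.\<close>

lemma Uperp_subset_T: "Uperp \<subseteq> T"
proof -
  define TT where "TT = {u + w | u w. u \<in> U \<and> w \<in> T}"
  have split: "a \<in> TT \<or> a \<in> Uperp" if "a \<in> roots" for a
  proof -
    obtain u w where "a = u + w" "u \<in> U" "w \<in> Uperp" by (rule decompose)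
    then show ?thesis using that by (cases "u = 0") (auto simp: TT_def T_def)
  qed
  have "p \<noteq> 0" using frame_pairs by auto
  then obtain a0 where a0: "a0 \<in> A" "b p a0" using nondegenerate_A by blast
  have A: "a \<in> TT" if "a \<in> A" for a
    using connected_A[OF a0(1) that]
  proof (induction rule: rtrancl_induct)
    case base
    have "a0 \<notin> Uperp" using U_perp frame_U a0 by blast
    then show ?case using split roots.simple a0 by blast
  next
    case (step y z)
    have yz: "y \<in> TT" "z \<in> roots" "b y z" using step roots.simple by auto
    show ?case
    proof (rule ccontr)
      assume "z \<notin> TT"
      then have z: "z \<in> Uperp" using split yz by blast
      obtain u w where w: "y = u + w" "u \<in> U" "w \<in> T" using yz by (auto simp: TT_def)
      then obtain v where v: "w \<in> Uperp" "v \<in> U" "v \<noteq> 0" "v + w \<in> roots" by (auto simp: T_def)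
      \<comment> \<open>Since \<open>z\<close> is orthogonal to \<open>U\<close>, only
        \<open>w\<close> contributes to \<open>b y z\<close>, and \<open>u\<close> may be replaced
        by \<open>v\<close>.\<close>
      have "b (v + w) z" using yz(3) U_perp w v z by (auto simp: b_add)
      then have "v + w + z \<in> roots" using yz v roots.add by blast
      then have "w + z \<in> T" using v z Uperp_add by (auto simp: T_def add.assoc)
      then have "w + (w + z) \<in> T" using T_add w by blast
      then have "z \<in> T" by simp
      then have "0 + z \<in> TT" using zero_U unfolding TT_def by blast
      then show False using \<open>z \<notin> TT\<close> by simp
    qed
  qed
  have 0: "0 \<in> T" using zero_U \<open>p \<noteq> 0\<close> frame_U frame_roots by (auto simp: T_def)
  have all: "v \<in> TT" for v
  proof (induction v rule: span_A)
    case zero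
    have "0 + 0 \<in> TT" using 0 zero_U unfolding TT_def by blast
    then show ?case by simp
  next
    case (add a v)
    then obtain u w u' w' where *: "a = u + w" "v = u' + w'" "u \<in> U" "u' \<in> U" "w \<in> T" "w' \<in> T"
      using A[OF add(1)] unfolding TT_def by blast
    then have "a + v = (u + u') + (w + w')" by (simp add: add_ac)
    then show ?case using * U_add T_add unfolding TT_def by blast
  qed
  show ?thesis
  proof
    fix w assume w: "w \<in> Uperp"
    obtain u w' where *: "w = u + w'" "u \<in> U" "w' \<in> T" using all[of w] by (auto simp: TT_def)
    then have "u = w + w'" by (simp add: ac)
    moreover have "w' \<in> Uperp" using *(3) by (simp add: T_def)
    ultimately have "u \<in> Uperp" using Uperp_add[OF w] by metis
    then have "u = 0" using * U_Uperp_0 by blast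
    then show "w \<in> T" using * by simp
  qed
qed

text \<open>\<open>T_root\<close> settles vectors with nonzero component in \<open>U\<close>. A
  vector \<open>w\<close> of \<open>Uperp\<close> is the sum of the nonorthogonal roots
  \<open>v + w1\<close> and \<open>v + (w + w1)\<close>.\<close>

lemma roots_iff_q: "x \<in> roots \<longleftrightarrow> q x"
proof
  assume "q x"
  obtain u w where x: "x = u + w" "u \<in> U" "w \<in> Uperp" by (rule decompose)
  show "x \<in> roots"
  proof (cases "u = 0")
    case False
    have "q u \<noteq> q w" using \<open>q x\<close> x U_perp by (auto simp: q_add)
    then show ?thesis using T_root Uperp_subset_T x False by blast
  next
    case True
    then have xw: "x = w" using x by simp
    then have "w \<noteq> 0" using \<open>q x\<close> by auto
    then obtain a where "b w a" using nondegenerate_A by blast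
    moreover obtain u' w1 where "a = u' + w1" "u' \<in> U" and w1: "w1 \<in> Uperp" by (rule decompose)
    ultimately have ww1: "b w w1" using U_perp x(3) by (auto simp: b_add)
    obtain v v' where v: "v \<in> U" "v' \<in> U" "v \<noteq> 0" "v' \<noteq> 0" "v + v' \<noteq> 0"
      "q v \<longleftrightarrow> \<not> q w1" "q v' \<longleftrightarrow> True" "b v v' \<longleftrightarrow> True" by (rule U_pair)
    have "q (w + w1) \<longleftrightarrow> q w1" using ww1 \<open>q x\<close> xw by (auto simp: q_add)
    moreover have "w1 \<in> T" "w + w1 \<in> T" using Uperp_subset_T w1 Uperp_add x(3) by blast+
    ultimately have "v + w1 \<in> roots" "v + (w + w1) \<in> roots"
      using T_root[of w1 v] T_root[of "w + w1" v] v by auto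
    moreover have "b (v + w1) (v + (w + w1))"
      using ww1 U_perp v w1 x(3) b_sym[of w w1] by (auto simp: b_add)
    ultimately have "v + w1 + (v + (w + w1)) \<in> roots" using roots.add by blast
    then show ?thesis by (simp add: xw ac)
  qed
qed (rule q_roots)

end

section \<open>From E_6 diagrams to transitivity\<close>

context binary_quadratic_space
begin

text \<open>This is the extended E_6 diagram with branch node \<open>x\<close>, inner nodes
  \<open>x + y\<close>, \<open>t\<close>, \<open>g\<close> and end nodes \<open>y + z\<close>,
  \<open>t + u\<close> and the highest root \<open>x + y + z + t + u\<close>. Removing
  \<open>x\<close> leaves 3A_2, and the marks 3, 2, 1 reduce modulo 2 to the identity that
  \<open>x\<close> is the sum of the end nodes.\<close>

lemma e6_frameI:
  assumes "e6_diagram x y z t u g"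
  shows "e6_frame b q A (y + z) (x + y) (t + u) t (x + y + z + t + u) g"
proof -
  have r: "x \<in> roots" "y \<in> roots" "z \<in> roots" "t \<in> roots" "u \<in> roots" "g \<in> roots"
    and e: "b x y" "b x z" "b x t" "b x u" "b y z" "b y t" "b y u" "b z t" "b z u" "b t u"
      "b g x" "b g y" "b g z" "\<not> b g t" "\<not> b g u"
    using assms by (auto simp: e6_diagram_def)
  have e': "b y x" "b z x" "b t x" "b u x" "b z y" "b t y" "b u y" "b t z" "b u z" "b u t"
      "b x g" "b y g" "b z g" "\<not> b t g" "\<not> b u g"
    using e b_sym by blast+
  note ee = e e' b_add
  have 1: "y + z \<in> roots" "x + y \<in> roots" "t + u \<in> roots" "y + t \<in> roots" "z + u \<in> roots"
    using r e roots.add by blast+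
  have "g + x \<in> roots" using roots.add[OF r(6,1)] e(11) by simp
  then have "g + x + (y + t) \<in> roots" by (rule roots.add) (use 1 in \<open>auto simp: ee\<close>)
  then have "g + x + (y + t) + (z + u) \<in> roots" by (rule roots.add) (use 1 in \<open>auto simp: ee\<close>)
  then have "g + (g + x + (y + t) + (z + u)) \<in> roots" by (rule roots.add[OF r(6)]) (simp add: ee)
  then have h: "x + y + z + t + u \<in> roots" by (simp add: ac)
  have s: "y + z + (t + u) + (x + y + z + t + u) = x" by (simp add: ac)
  show ?thesis by unfold_locales (use 1 h r in \<open>simp_all add: ee s\<close>)
qed

end

context binary_quadratic_space
begin

lemma moves_invariant:
  assumes "(v, w) \<in> moves\<^sup>*" shows "q w \<longleftrightarrow> q v" "w = 0 \<longleftrightarrow> v = 0"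
proof -
  have *: "q y \<longleftrightarrow> q x" "y \<noteq> 0" "x \<noteq> 0" if "(x, y) \<in> moves" for x y
  proof -
    obtain a where a: "a \<in> A" "b x a" "y = x + a" using \<open>(x, y) \<in> moves\<close> by (auto simp: moves_def)
    show "q y \<longleftrightarrow> q x" using a q_A by (auto simp: q_add)
    show "y \<noteq> 0" "x \<noteq> 0" using a add_eq_0[of x a] b_self b_zero by auto
  qed
  show "q w \<longleftrightarrow> q v" using assms by induction (use *(1) in auto)
  show "w = 0 \<longleftrightarrow> v = 0" using assms by induction (use *(2,3) in auto)
qed

text \<open>In the second case the singular vector \<open>v\<close> guarantees that the value 0 of
  \<open>q\<close> also occurs on a nonzero vector.\<close>

lemma pairs_or_transitive:
  assumes "A \<noteq> {}"
  obtains (pairs) C where "clique C"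
    "\<And>a. a \<in> A \<Longrightarrow> \<exists>i\<in>insert 0 C. \<exists>j\<in>insert 0 C. i \<noteq> j \<and> a = i + j"
  | (transitive) v where "v \<noteq> 0" "\<not> q v"
    "\<And>v w. v \<noteq> 0 \<Longrightarrow> w \<noteq> 0 \<Longrightarrow> (q v \<longleftrightarrow> q w) \<Longrightarrow> (v, w) \<in> moves\<^sup>*"
proof (cases "\<exists>x y z t u g. e6_diagram x y z t u g")
  case True
  then obtain x y z t u g where "e6_diagram x y z t u g" by blast
  then interpret e6_frame b q A "y + z" "x + y" "t + u" t "x + y + z + t + u" g by (rule e6_frameI)
  obtain v v' where v: "v \<noteq> 0" "q v \<longleftrightarrow> False" "q v' \<longleftrightarrow> True" "b v v' \<longleftrightarrow> True" by (rule U_pair)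
  have "(v, w) \<in> moves\<^sup>*" if "v \<noteq> 0" "w \<noteq> 0" "q v \<longleftrightarrow> q w" for v w
    using that moves_roots moves_singular roots_iff_q by (cases "q v") auto
  then show ?thesis using transitive[of v] v by blast
next
  case False
  then show ?thesis using simple_roots_pairs[OF assms] pairs by metis
qed

end

section \<open>Dual bases\<close>

locale binary_quadratic_basis = binary_quadratic_space b q "range a"
  for b :: "'v::{ab_group_add,finite} \<Rightarrow> 'v \<Rightarrow> bool" and q and a :: "'s::finite \<Rightarrow> 'v" +
  fixes d :: "'s \<Rightarrow> 'v"
  assumes dual: "b (d s) (a t) \<longleftrightarrow> s = t"
begin

text \<open>These are the coordinates of \<open>v\<close> in the basis \<open>d\<close>, and the on
  vertices of the configuration given by \<open>v\<close>.\<close>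

definition support :: "'v \<Rightarrow> 's set" where
  "support v = {t. b v (a t)}"

lemma eqI_support: "support v = support w \<Longrightarrow> v = w"
proof -
  assume "support v = support w"
  then have "v + w = 0" by (intro nondegenerate_A) (auto simp: support_def b_add)
  then show ?thesis by (simp add: add_eq_0)
qed

lemma support_zero [simp]: "support 0 = {}"
  by (simp add: support_def)

lemma support_dual [simp]: "support (d s) = {s}"
  by (auto simp: support_def dual)

lemma support_add: "support (v + w) = (support v - support w) \<union> (support w - support v)"
  by (auto simp: support_def b_add)

lemma inj_a: "inj a"
  by (rule injI) (metis dual)

lemma ex_support: "\<exists>v. support v = T"
proof -
  have "finite T" by simp
  then show ?thesis
  proof (induction T)
    case empty
    show ?case by (rule exI[of _ 0]) simp
  next
    case (insert s T)
    then obtain v where "support v = T" by blast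
    then have "support (d s + v) = insert s T" using insert by (auto simp: support_add)
    then show ?case by blast
  qed
qed

lemma dual_span [case_names zero add]:
  assumes "P 0" "\<And>s v. P v \<Longrightarrow> P (d s + v)" shows "P v"
proof -
  have "finite (support v)" by simp
  moreover have "support v = T \<Longrightarrow> P v" if "finite T" for T
    using that
  proof (induction T arbitrary: v)
    case empty
    then have "v = 0" by (intro eqI_support) simp
    then show ?case using assms by simp
  next
    case (insert s T)
    then have "support (d s + v) = T" by (auto simp: support_add)
    then have "P (d s + (d s + v))" using insert.IH assms by blast
    then show ?case by simp
  qed
  ultimately show ?thesis by blast
qed

lemma nondegenerate_dual:
  assumes "\<And>s. \<not> b v (d s)" shows "v = 0"
proof (rule nondegenerate_A)
  show "\<not> b v x" for x by (induction x rule: dual_span) (use assms in \<open>auto simp: b_add\<close>)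
qed

text \<open>Here \<open>a t = \<sigma> + d t\<close>, where \<open>\<sigma>\<close> is the sum of the dual basis; it also pairs to 1 with each \<open>d t\<close>.\<close>

lemma complete_pairs:
  assumes full: "\<And>s t. s \<noteq> t \<Longrightarrow> b (d s) (d t)"
  obtains C where "clique C"
    "\<And>x. x \<in> range a \<Longrightarrow> \<exists>i\<in>insert 0 C. \<exists>j\<in>insert 0 C. i \<noteq> j \<and> x = i + j"
proof -
  obtain \<sigma> where \<sigma>: "support \<sigma> = UNIV" using ex_support by blast
  have bd: "b (d s) (d t) \<longleftrightarrow> s \<noteq> t" for s t using full by auto
  have da: "b (a s) (d t) \<longleftrightarrow> s = t" for s t using dual[of t s] b_sym[of "a s" "d t"] by auto
  have \<sigma>a: "b \<sigma> (a t)" for t using \<sigma> by (auto simp: support_def)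
  \<comment> \<open>The sums \<open>d s + d t\<close> and \<open>a s + a t\<close> have equal
    pairings with the dual basis, and \<sigma> is orthogonal to the second.\<close>
  have const: "b \<sigma> (d s) \<longleftrightarrow> b \<sigma> (d t)" for s t
  proof -
    have "d s + d t + (a s + a t) = 0" by (rule nondegenerate_dual) (auto simp: b_add bd da)
    then have "d s + d t = a s + a t" by (simp add: add_eq_0)
    then have "b \<sigma> (d s + d t) \<longleftrightarrow> b \<sigma> (a s + a t)" by simp
    then show ?thesis using \<sigma>a by (auto simp: b_add)
  qed
  have \<sigma>0: "\<sigma> \<noteq> 0" using \<sigma> by auto
  then obtain s0 where "b \<sigma> (d s0)" using nondegenerate_dual by blast
  then have \<sigma>d: "b \<sigma> (d t)" for t using const by blast
  have "d s \<noteq> 0" for s using dual[of s s] by auto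
  then have "clique (range d)" using bd unfolding clique_def by (metis imageE)
  then have cl: "clique (insert \<sigma> (range d))" by (rule clique_insert) (use \<sigma>d \<sigma>0 in auto)
  have "a t = \<sigma> + d t" "\<sigma> \<noteq> d t" for t
  proof -
    have "a t + (\<sigma> + d t) = 0" by (rule nondegenerate_dual) (auto simp: b_add bd da \<sigma>d)
    then show "a t = \<sigma> + d t" by (simp add: add_eq_0)
    show "\<sigma> \<noteq> d t" using \<sigma>d[of t] by auto
  qed
  then show ?thesis by (intro that[OF cl]) blast
qed

text \<open>If no dual vector has value \<open>c\<close>, all have the other one, so
  \<open>q (d s + d t)\<close> equals \<open>b (d s) (d t)\<close>. These pairings cannot all be 0
  off the diagonal by nondegeneracy, nor all 1 by \<open>complete_pairs\<close>.\<close>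

lemma small_support_representatives:
  assumes no_pairs: "\<nexists>C. clique C \<and> (\<forall>x\<in>range a. \<exists>i\<in>insert 0 C. \<exists>j\<in>insert 0 C. i \<noteq> j \<and> x = i + j)"
  shows "\<exists>w. w \<noteq> 0 \<and> card (support w) \<le> 2 \<and> (q w \<longleftrightarrow> c)"
proof (cases "\<exists>s. q (d s) \<longleftrightarrow> c")
  case True
  then obtain s where "q (d s) \<longleftrightarrow> c" by blast
  moreover have "d s \<noteq> 0" using dual[of s s] by auto
  ultimately show ?thesis by (intro exI[of _ "d s"]) simp
next
  case False
  have "\<exists>s t. s \<noteq> t \<and> (b (d s) (d t) \<longleftrightarrow> c)"
  proof (rule ccontr)
    assume n: "\<not> ?thesis"
    show False
    proof (cases c)
      case True
      have "d s = 0" for s using nondegenerate_dual[of "d s"] n True b_self by metis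
      then show False using dual by (metis b_zero(1))
    next
      case False
      then show False using n complete_pairs no_pairs by metis
    qed
  qed
  then obtain s t where st: "s \<noteq> t" "b (d s) (d t) \<longleftrightarrow> c" by blast
  have "support (d s + d t) = {s, t}" using st by (auto simp: support_add)
  moreover from this have "d s + d t \<noteq> 0" by (metis support_zero insert_not_empty)
  moreover have "q (d s + d t) \<longleftrightarrow> c" using False st by (auto simp: q_add)
  ultimately show ?thesis using st by (intro exI[of _ "d s + d t"]) simp
qed

end

section \<open>The game as a walk of transvections\<close>

instance bit :: finite
proof
  have "(UNIV :: bit set) = {0, 1}" using bit_not_zero_iff by blast
  then show "finite (UNIV :: bit set)" by (metis finite.emptyI finite_insert)
qed

lemma bit_add_eq_1_iff: "x + y = 1 \<longleftrightarrow> (x = 1) \<noteq> (y = 1)" for x y :: bit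
  by (cases x; cases y) simp_all

lemma bit_eqI: "(x = 1 \<longleftrightarrow> y = 1) \<Longrightarrow> x = y" for x y :: bit
  by (cases x; cases y) simp_all

lemma bit_vec_double: "x + x = 0" for x :: "bit ^ 'n"
proof -
  have "c + c = 0" for c :: bit by (cases c) simp_all
  then show ?thesis by (simp only: vec_eq_iff vector_add_component zero_index simp_thms)
qed

lemma alpha_span [case_names zero add]:
  fixes v :: "bit ^ 's::finite"
  assumes "P 0" "\<And>s v. P v \<Longrightarrow> P (alpha s + v)" shows "P v"
proof -
  have "P (\<Sum>s\<in>A. v $ s *s alpha s)" if "finite A" for A
    using that
  proof (induction A)
    case empty
    then show ?case using assms(1) by (simp only: sum.empty)
  next
    case (insert s A)
    show ?case
    proof (cases "v $ s")
      assume "v $ s = 0"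
      show ?thesis
        unfolding sum.insert[OF insert.hyps] \<open>v $ s = 0\<close> vec.scale_zero_left add_0 by (rule insert.IH)
    next
      assume "v $ s = 1"
      show ?thesis
        unfolding sum.insert[OF insert.hyps] \<open>v $ s = 1\<close> vec.scale_one by (rule assms(2)[OF insert.IH])
    qed
  qed
  from this[of UNIV] show ?thesis unfolding alpha_def by (simp only: basis_expansion finite)
qed

lemma B_form_sym: "B_form R x y = B_form R y x"
  unfolding B_form_def by (subst sum.swap) (simp only: mult_ac insert_commute)

lemma B_form_zero: "B_form R x 0 = 0"
  unfolding B_form_def by (simp only: zero_index mult_zero_left mult_zero_right sum.neutral_const)

lemma sum_dual_basis: "(\<Sum>t | {s, t} \<in> R. dual_basis t v) = B_form R (alpha s) v"
proof (induction v rule: alpha_span)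
  case zero
  show ?case by (simp only: dual_basis_def zero_index sum.neutral_const B_form_zero)
next
  case (add u v)
  have "(\<Sum>t | {s, t} \<in> R. dual_basis t (alpha u)) = (if {s, u} \<in> R then 1 else 0)"
    unfolding dual_basis_alpha by (subst sum.delta) simp_all
  moreover have "(\<Sum>t | {s, t} \<in> R. dual_basis t (alpha u + v)) =
      (\<Sum>t | {s, t} \<in> R. dual_basis t (alpha u)) + (\<Sum>t | {s, t} \<in> R. dual_basis t v)"
    unfolding dual_basis_def vector_add_component sum.distrib ..
  ultimately show ?case by (simp only: add B_form_add_right B_form_alpha)
qed

text \<open>By \<open>sum_dual_basis\<close> the toggled functional is
  \<open>B_form R (alpha s)\<close>, so the move is a transvection.\<close>

lemma kappa_B_form:
  "kappa R s (B_form R v) = B_form R (if B_form R v (alpha s) = 1 then v + alpha s else v)"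
proof (cases "B_form R v (alpha s)")
  assume "B_form R v (alpha s) = 0"
  then show ?thesis unfolding kappa_def sum_dual_basis by (simp only: mult_zero_left add_0_right zero_neq_one if_False)
next
  assume "B_form R v (alpha s) = 1"
  then show ?thesis
    unfolding kappa_def sum_dual_basis by (simp only: mult_1_left simp_thms if_True fun_eq_iff B_form_add_left)
qed

text \<open>The summands of \<open>a s\<close> become the endpoints of an edge;
  \<open>b_clique_pairs\<close> identifies nonorthogonality with sharing an endpoint.\<close>

lemma (in binary_quadratic_space) is_line_graphI_pairs:
  fixes a :: "'s::finite \<Rightarrow> 'v"
  assumes "simple_graph UNIV R" "inj a" and adj: "\<And>s t. b (a s) (a t) \<longleftrightarrow> {s, t} \<in> R"
    and C: "clique C" "\<And>s. \<exists>i\<in>insert 0 C. \<exists>j\<in>insert 0 C. i \<noteq> j \<and> a s = i + j"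
  shows "is_line_graph UNIV R"
proof -
  obtain i j where ij: "i s \<in> insert 0 C" "j s \<in> insert 0 C" "i s \<noteq> j s" "a s = i s + j s" for s
    using C(2) by metis
  define \<phi> where "\<phi> s = {i s, j s}" for s
  let ?E = "range \<phi>"
  have \<phi>_eq: "s = t" if "\<phi> s = \<phi> t" for s t
  proof -
    have "i s + j s = i t + j t" using that by (auto simp: \<phi>_def doubleton_eq_iff add.commute)
    then show ?thesis using ij(4) \<open>inj a\<close> by (metis injD)
  qed
  have "simple_graph UNIV ?E" using ij(3) by (auto simp: simple_graph_def \<phi>_def)
  moreover have "bij_betw \<phi> UNIV ?E" using \<phi>_eq by (auto simp: bij_betw_def inj_def)
  moreover have "{s, t} \<in> R \<longleftrightarrow> {\<phi> s, \<phi> t} \<in> line_graph_edges ?E" for s t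
  proof (cases "s = t")
    case True
    have "{s, t} \<notin> R" using assms(1) True by (auto simp: simple_graph_def)
    then show ?thesis using True doubleton_in_line_graph_edges[of "\<phi> s" ?E "\<phi> t"] by blast
  next
    case False
    then have "\<phi> s \<noteq> \<phi> t" using \<phi>_eq by blast
    then have "b (a s) (a t) \<longleftrightarrow> \<phi> s \<inter> \<phi> t \<noteq> {}"
      unfolding \<phi>_def using b_clique_pairs[OF C(1) ij(1,2) ij(1,2) ij(3) ij(3)] by (simp only: ij(4))
    then show ?thesis using \<open>\<phi> s \<noteq> \<phi> t\<close> adj doubleton_in_line_graph_edges[of "\<phi> s" ?E "\<phi> t"] by blast
  qed
  ultimately show ?thesis by (intro is_line_graphI[of UNIV UNIV ?E]) (auto simp: graph_isomorphic_def)
qed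

lemma binary_quadratic_basis_graph:
  fixes R :: "'s::finite set set"
  assumes R: "simple_graph UNIV R" "connected_graph UNIV R" "nondegenerate R"
  shows "binary_quadratic_basis (\<lambda>x y. B_form R x y = 1) (\<lambda>x. Q_form R x = 1) alpha (alpha_dual R)"
proof unfold_locales
  fix x y z :: "bit ^ 's"
  have Q: "is_Q_form R (Q_form R)" by (rule is_Q_form_Q_form[OF R(1)])
  show "x + x = 0" by (rule bit_vec_double)
  show "B_form R (x + y) z = 1 \<longleftrightarrow> (B_form R x z = 1) \<noteq> (B_form R y z = 1)"
    unfolding B_form_add_left by (rule bit_add_eq_1_iff)
  show "B_form R x y = 1 \<longleftrightarrow> B_form R y x = 1" by (simp only: B_form_sym)
  have "Q_form R (x + y) = Q_form R x + (Q_form R y + B_form R x y)"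
    using Q unfolding is_Q_form_def by (metis add.assoc)
  then show "Q_form R (x + y) = 1 \<longleftrightarrow> (Q_form R x = 1) \<noteq> ((Q_form R y = 1) \<noteq> (B_form R x y = 1))"
    by (simp only: bit_add_eq_1_iff)
  show "Q_form R x = 1" if "x \<in> range alpha" using that Q unfolding is_Q_form_def by blast
  show "(x, y) \<in> {(x, y). x \<in> range alpha \<and> y \<in> range alpha \<and> B_form R x y = 1}\<^sup>*"
    if xy: "x \<in> range alpha" "y \<in> range alpha"
  proof -
    obtain s t where st: "x = alpha s" "y = alpha t" using xy by blast
    have "(s, t) \<in> {(x, y). {x, y} \<in> R}\<^sup>*" using R(2) by (simp add: connected_graph_def)
    then show ?thesis unfolding st
    proof (induction rule: rtrancl_induct)
      case (step u v)
      then have "(alpha u, alpha v) \<in> {(x, y). x \<in> range alpha \<and> y \<in> range alpha \<and> B_form R x y = 1}"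
        by (simp add: B_form_alpha)
      with step.IH show ?case by (rule rtrancl_into_rtrancl)
    qed simp
  qed
  show "x = 0" if n: "\<And>a. a \<in> range alpha \<Longrightarrow> B_form R x a \<noteq> 1"
  proof -
    have "B_form R x y = 0" for y
    proof (induction y rule: alpha_span)
      case (add s v)
      have "B_form R x (alpha s) = 0" using n[of "alpha s"] bit_not_one_iff by blast
      then show ?case by (simp only: add B_form_add_right add_0)
    qed (rule B_form_zero)
    then show ?thesis using R(3) unfolding nondegenerate_def by blast
  qed
  show "P x" if "P 0" "\<And>a v. a \<in> range alpha \<Longrightarrow> P v \<Longrightarrow> P (a + v)" for P
    using that by (induction x rule: alpha_span) blast+
  show "B_form R (alpha_dual R s) (alpha t) = 1 \<longleftrightarrow> s = t" for s t
    by (simp add: B_form_alpha_dual[OF R(3)])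
qed

theorem theorem3p2:
  fixes R :: "'s::finite set set"
  assumes "simple_graph (UNIV :: 's set) R"
    and "connected_graph (UNIV :: 's set) R"
    and "nondegenerate R"
    and "\<not> is_line_graph (UNIV :: 's set) R"
  shows "k_lit R 2 \<and>
    (k_lit R 1 \<longleftrightarrow> Q_form R ` {alpha_dual R s | s. s \<in> UNIV} = (UNIV :: bit set))"
proof -
  let ?b = "\<lambda>x y. B_form R x y = 1" and ?q = "\<lambda>x. Q_form R x = 1"
  interpret binary_quadratic_basis ?b ?q alpha "alpha_dual R"
    by (rule binary_quadratic_basis_graph[OF assms(1-3)])
  have adj: "B_form R (alpha s) (alpha t) = 1 \<longleftrightarrow> {s, t} \<in> R" for s t
    by (simp add: B_form_alpha)
  have no_pairs: "\<nexists>C. clique C \<and> (\<forall>x\<in>range alpha. \<exists>i\<in>insert 0 C. \<exists>j\<in>insert 0 C. i \<noteq> j \<and> x = i + j)"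
  proof
    assume "\<exists>C. clique C \<and> (\<forall>x\<in>range alpha. \<exists>i\<in>insert 0 C. \<exists>j\<in>insert 0 C. i \<noteq> j \<and> x = i + j)"
    then obtain C where C: "clique C" "\<And>s. \<exists>i\<in>insert 0 C. \<exists>j\<in>insert 0 C. i \<noteq> j \<and> alpha s = i + j"
      by blast
    show False using is_line_graphI_pairs[OF assms(1) inj_a adj C] assms(4) by blast
  qed
  obtain v0 where v0: "v0 \<noteq> 0" "\<not> ?q v0"
    and transitive: "\<And>v w. v \<noteq> 0 \<Longrightarrow> w \<noteq> 0 \<Longrightarrow> (?q v \<longleftrightarrow> ?q w) \<Longrightarrow> (v, w) \<in> moves\<^sup>*"
  proof (rule pairs_or_transitive)
    show "range alpha \<noteq> {}" by blast
  next
    fix C assume "clique C"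
      "\<And>a. a \<in> range alpha \<Longrightarrow> \<exists>i\<in>insert 0 C. \<exists>j\<in>insert 0 C. i \<noteq> j \<and> a = i + j"
    with no_pairs show thesis by blast
  qed (rule that)
  have on: "on_vertices (B_form R v) = support v" for v
    by (simp add: on_vertices_def support_def)
  \<comment> \<open>The vector wanted is the sum of the dual basis vectors at the on vertices of
    \<open>f\<close>.\<close>
  have rep: "\<exists>v. f = B_form R v" if f: "f \<in> dual_space" for f
  proof -
    interpret f: Vector_Spaces.linear "(*s)" "(*)" f using f by (simp add: dual_space_def)
    obtain v where v: "support v = on_vertices f" using ex_support by blast
    have "f x = B_form R v x" for x
    proof (induction x rule: alpha_span)
      case zero
      show ?case by (simp only: f.zero B_form_zero)
    next
      case (add s x)
      have "f (alpha s) = B_form R v (alpha s)"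
        using v by (intro bit_eqI) (auto simp: support_def on_vertices_def)
      then show ?case by (simp only: f.add B_form_add_right add)
    qed
    then show ?thesis by blast
  qed
  have B_dual: "B_form R v \<in> dual_space" for v
    unfolding dual_space_def mem_Collect_eq
    by unfold_locales (simp_all only: B_form_add_right B_form_scale_right)
  have fold_moves: "\<exists>w. fold (kappa R) ms (B_form R v) = B_form R w \<and> (v, w) \<in> moves\<^sup>*" for ms v
  proof (induction ms arbitrary: v)
    case (Cons s ms)
    let ?w = "if B_form R v (alpha s) = 1 then v + alpha s else v"
    have "(v, ?w) \<in> moves\<^sup>*" by (auto simp: moves_def)
    moreover obtain w where w: "fold (kappa R) ms (B_form R ?w) = B_form R w" "(?w, w) \<in> moves\<^sup>*"
      using Cons.IH by blast
    ultimately have "(v, w) \<in> moves\<^sup>*" by (meson rtrancl_trans)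
    moreover have "fold (kappa R) (s # ms) (B_form R v) = B_form R w"
      by (simp only: fold_simps kappa_B_form w)
    ultimately show ?case by blast
  qed auto
  have moves_fold: "\<exists>ms. fold (kappa R) ms (B_form R v) = B_form R w" if "(v, w) \<in> moves\<^sup>*" for v w
    using that
  proof (induction rule: rtrancl_induct)
    case base
    have "fold (kappa R) [] (B_form R v) = B_form R v" by simp
    then show ?case by blast
  next
    case (step x y)
    then obtain ms s where ms: "fold (kappa R) ms (B_form R v) = B_form R x"
      and s: "B_form R x (alpha s) = 1" "y = x + alpha s" by (auto simp: moves_def)
    have "fold (kappa R) (ms @ [s]) (B_form R v) = B_form R y"
      using ms s by (simp add: kappa_B_form)
    then show ?case by blast
  qed
  \<comment> \<open>The nonzero vectors form two orbits, one per value of \<open>q\<close>, so each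
    needs a representative of small support. The zero configuration has no on vertices, which is
    within \<open>k\<close> as \<open>k \<ge> 0\<close>.\<close>
  have lit: "k_lit R k \<longleftrightarrow> (\<forall>c. \<exists>w. w \<noteq> 0 \<and> int (card (support w)) \<le> k \<and> (?q w \<longleftrightarrow> c))" (is "_ \<longleftrightarrow> ?rhs")
    if "k \<ge> 0" for k
  proof
    assume k: "k_lit R k"
    show ?rhs
    proof
      fix c
      \<comment> \<open>Both values occur: \<open>alpha s\<close> has value 1 and \<open>v0\<close>
        has value 0.\<close>
      have "\<exists>v. v \<noteq> 0 \<and> (?q v \<longleftrightarrow> c)"
        using v0 q_A[OF rangeI] q_zero by metis
      then obtain v where v: "v \<noteq> 0" "?q v \<longleftrightarrow> c" by blast
      obtain ms where ms: "int (card (on_vertices (fold (kappa R) ms (B_form R v)))) \<le> k"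
        using k B_dual unfolding k_lit_def by blast
      obtain w where w: "fold (kappa R) ms (B_form R v) = B_form R w" "(v, w) \<in> moves\<^sup>*"
        using fold_moves by blast
      show "\<exists>w. w \<noteq> 0 \<and> int (card (support w)) \<le> k \<and> (?q w \<longleftrightarrow> c)"
        using moves_invariant[OF w(2)] v ms w(1) by (intro exI[of _ w]) (simp only: on simp_thms)
    qed
  next
    assume rhs: ?rhs
    show "k_lit R k" unfolding k_lit_def
    proof
      fix f :: "bit ^ 's \<Rightarrow> bit" assume "f \<in> dual_space"
      then obtain v where v: "f = B_form R v" using rep by blast
      have "\<exists>w. (v, w) \<in> moves\<^sup>* \<and> int (card (support w)) \<le> k"
      proof (cases "v = 0")
        case True
        then show ?thesis using that by (intro exI[of _ 0]) simp
      next
        case False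
        then show ?thesis using rhs transitive by metis
      qed
      then show "\<exists>ms. int (card (on_vertices (fold (kappa R) ms f))) \<le> k"
        using moves_fold v on by metis
    qed
  qed
  have single: "w \<noteq> 0 \<and> int (card (support w)) \<le> 1 \<longleftrightarrow> (\<exists>s. w = alpha_dual R s)" for w
  proof
    assume w: "w \<noteq> 0 \<and> int (card (support w)) \<le> 1"
    then have "support w \<noteq> {}" using eqI_support[of w 0] by auto
    then have "card (support w) \<noteq> 0" by simp
    then have "card (support w) = 1" using w by linarith
    then obtain s where "support w = {s}" by (auto simp: card_1_singleton_iff)
    then show "\<exists>s. w = alpha_dual R s" using eqI_support[of w "alpha_dual R s"] by auto
  next
    assume "\<exists>s. w = alpha_dual R s"
    then obtain s where s: "w = alpha_dual R s" by blast
    then have "support w = {s}" by simp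
    then show "w \<noteq> 0 \<and> int (card (support w)) \<le> 1" by auto
  qed
  have "k_lit R 1 \<longleftrightarrow> (\<forall>c. \<exists>s. ?q (alpha_dual R s) \<longleftrightarrow> c)"
    using lit[of 1] single by (metis zero_le_one)
  also have "\<dots> \<longleftrightarrow> (\<forall>x. \<exists>s. Q_form R (alpha_dual R s) = x)"
  proof (intro iffI allI)
    fix x :: bit assume "\<forall>c. \<exists>s. ?q (alpha_dual R s) \<longleftrightarrow> c"
    then obtain s where "?q (alpha_dual R s) \<longleftrightarrow> x = 1" by blast
    then show "\<exists>s. Q_form R (alpha_dual R s) = x" using bit_eqI by blast
  next
    fix c assume "\<forall>x. \<exists>s. Q_form R (alpha_dual R s) = x"
    then obtain s where "Q_form R (alpha_dual R s) = of_bool c" by blast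
    then show "\<exists>s. ?q (alpha_dual R s) \<longleftrightarrow> c" by (intro exI[of _ s]) simp
  qed
  also have "\<dots> \<longleftrightarrow> Q_form R ` {alpha_dual R s | s. s \<in> UNIV} = UNIV"
    by (auto simp only: set_eq_iff image_iff mem_Collect_eq UNIV_I simp_thms eq_commute)
  finally have "k_lit R 1 \<longleftrightarrow> Q_form R ` {alpha_dual R s | s. s \<in> UNIV} = UNIV" .
  moreover have "k_lit R 2" using lit[of 2] small_support_representatives[OF no_pairs] by simp
  ultimately show ?thesis by blast
qed

end
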